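(* Let $(b_n)_{n\ge1}$ be a sequence in $(1,\infty)$ such that $b_n/n$ is non-decreasing and tends to $\infty$. Then \[ \limsup_{n\to\infty}\frac1{b_n}\sum_{k=1}^n\mathsf a'_k=\infty\ \text{a.e.}\quad\Longleftrightarrow\quad \sum_{n\ge1}\frac{1}{b_n\log b_n}=\infty, \] and if the series converges, then $\lim_{n\to\infty}\frac1{b_n}\sum_{k=1}^n\mathsf a'_k=0$ almost everywhere.
   Context: $I=(0,1]$, $\lambda$ is Lebesgue measure on $I$ ("a.e." refers to $\lambda$), and $\mathsf a_n(x)$ denotes the $n$-th continued fraction digit of $x\in I$. $\mathbb P$ is the set of primes. The prime digits are $\mathsf a'_n(x):=\mathsf a_n(x)$ if $\mathsf a_n(x)\in\mathbb P$ and $\mathsf a'_n(x):=0$ otherwise. *)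

theory Defs
  imports "HOL-Analysis.Analysis" "HOL-Computational_Algebra.Primes"
begin

(* Gauss map T x = 1/x - floor(1/x); note 1/0 = 0 in Isabelle, so T 0 = 0 *)
definition gauss_map :: "real \<Rightarrow> real" where
  "gauss_map x = 1 / x - of_int \<lfloor>1 / x\<rfloor>"

(* n-th continued fraction digit a_n(x), n >= 1: a_n(x) = floor(1 / T^(n-1) x).
   (For rational x, once the expansion terminates the value is 0; a null set.) *)
definition cf_digit :: "nat \<Rightarrow> real \<Rightarrow> nat" where
  "cf_digit n x = nat \<lfloor>1 / (gauss_map ^^ (n - 1)) x\<rfloor>"

definition prime_digit :: "nat \<Rightarrow> real \<Rightarrow> nat" where
  "prime_digit n x = (if prime (cf_digit n x) then cf_digit n x else 0)"

end

theory Submission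
  imports Defs "HOL-Real_Asymp.Real_Asymp"
begin

text \<open>Give \<open>(0, 1)\<close> the density \<open>(1 + s) / (1 + s x)\<^sup>2\<close>, which is Lebesgue measure for \<open>s = 0\<close>.
  The first digit is then \<open>j\<close> with probability \<open>(1 + s) / ((j + s) (j + s + 1))\<close>, and given this the
  Gauss map has the same kind of law with \<open>s\<close> replaced by \<open>1 / (j + s)\<close>. These probabilities are
  comparable to \<open>1 / j\<^sup>2\<close> uniformly in \<open>s \<in> [0, 1]\<close>, so expectations of products of functions of the
  digits are bounded by products, as if the digits were independent.

  With Chebyshev's estimates a prime digit exceeds \<open>t\<close> with probability comparable to
  \<open>1 / (t ln t)\<close>. If the series diverges, for every \<open>K\<close> infinitely many prime digits exceed \<open>K b\<^sub>n\<close>. If it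
  converges, then \<open>ln ln b\<^sub>n = o(b\<^sub>n / n)\<close>, so the truncated sums have mean \<open>o(b\<^sub>n)\<close>; a union bound for
  the large digits and an exponential moment for the truncated ones give summable probabilities along
  \<open>n = 2\<^sup>j\<close>.\<close>

section \<open>Chebyshev estimates\<close>

text \<open>Only Chebyshev orders of magnitude are used, since constant factors do not affect
  convergence of the series. The comparison of expectations with products is one-sided. It still
  serves both halves, because exponential moments and probabilities of avoiding large digits are
  expectations of products of nonnegative functions; a variance estimate would instead need
  covariances, that is, mixing of the Gauss map. The obstacle in the convergent case is the mean: a
  prime digit truncated at \<open>t\<close> has mean of order \<open>ln ln t\<close>, whereas the
  series only speaks of tails. That convergence also controls the mean rests on the monotonicity of
  \<open>b n / n\<close>. Powers of two are forced by the union bound: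
  \<open>n / (b n * ln (b n))\<close> need not be summable over all \<open>n\<close>, but over
  powers of two it is the condensed series. Nothing is lost in between, as the sums and
  \<open>b\<close> are monotone.\<close>

lemma prod_primes_dvd:
  fixes n :: nat
  assumes "finite A" "\<And>p. p \<in> A \<Longrightarrow> prime p" "\<And>p. p \<in> A \<Longrightarrow> p dvd n"
  shows "\<Prod>A dvd n"
  using assms
proof (induction A rule: finite_induct)
  case (insert p A)
  have "coprime p (\<Prod>A)"
    using insert by (intro prod_coprime_right) (metis insertI1 insertI2 primes_coprime)
  then show ?case using insert by (simp add: divides_mult)
qed simp

definition dyadic_primes :: "nat \<Rightarrow> nat set" where
  "dyadic_primes i = {p. prime p \<and> 2 ^ i < p \<and> p \<le> 2 ^ Suc i}"

lemma finite_dyadic_primes [simp]: "finite (dyadic_primes i)"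
  by (rule finite_subset[of _ "{..2 ^ Suc i}"]) (auto simp: dyadic_primes_def)

text \<open>Chebyshev's argument with \<open>n = 2 ^ i\<close>: a prime between \<open>n\<close> and
  \<open>2 * n\<close> divides \<open>fact (2 * n)\<close> but not \<open>fact n\<close>, hence the
  central binomial coefficient. The latter is at most \<open>2 ^ (2 * n)\<close>, while each of
  these primes exceeds \<open>2 ^ i\<close>.\<close>

lemma card_dyadic_primes: "i * card (dyadic_primes i) \<le> 2 ^ Suc i"
proof -
  let ?n = "2 ^ i :: nat" and ?A = "dyadic_primes i"
  have dvd: "p dvd (2 * ?n) choose ?n" if "p \<in> ?A" for p
  proof -
    have p: "prime p" "?n < p" "p \<le> 2 * ?n" using that by (auto simp: dyadic_primes_def)
    have "p dvd fact (2 * ?n)" using p prime_dvd_fact_iff by blast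
    moreover have "fact ?n * fact (2 * ?n - ?n) * ((2 * ?n) choose ?n) = (fact (2 * ?n) :: nat)"
      by (rule binomial_fact_lemma) simp
    ultimately have "p dvd fact ?n * fact ?n * ((2 * ?n) choose ?n)" by simp
    moreover have "\<not> p dvd fact ?n" using p by (simp add: prime_dvd_fact_iff)
    ultimately show ?thesis using p(1) by (simp add: prime_dvd_mult_iff)
  qed
  have "\<Prod>?A dvd (2 * ?n) choose ?n"
    by (rule prod_primes_dvd) (use dvd in \<open>auto simp: dyadic_primes_def\<close>)
  then have "\<Prod>?A \<le> (2 * ?n) choose ?n"
    by (rule dvd_imp_le) simp
  also have "\<dots> \<le> 2 ^ (2 * ?n)" by (rule binomial_le_pow2)
  finally have up: "\<Prod>?A \<le> 2 ^ (2 * ?n)" .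
  have "(2 ^ i) ^ card ?A \<le> \<Prod>?A"
    using prod_mono[of ?A "\<lambda>_. 2 ^ i" "\<lambda>p. p"] by (auto simp: dyadic_primes_def)
  with up have "(2::nat) ^ (i * card ?A) \<le> 2 ^ (2 * ?n)"
    by (simp add: power_mult)
  then show ?thesis by (simp only: power_increasing_iff) simp
qed

section \<open>Lower bound for the number of primes through common multiples\<close>

lemma prime_power_bound_ex:
  fixes n p :: nat
  assumes "n > 0" "prime p"
  shows "\<exists>e. p ^ e \<le> n \<and> (\<forall>k. p ^ k \<le> n \<longrightarrow> k \<le> e)"
proof -
  have p: "Suc 0 < p" using assms prime_gt_1_nat by simp
  have bd: "k \<le> n" if "p ^ k \<le> n" for k
    using that power_gt_expt[OF p, of k] by linarith
  let ?S = "{k. p ^ k \<le> n}"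
  have fin: "finite ?S" by (rule finite_subset[of _ "{..n}"]) (use bd in auto)
  have "0 \<in> ?S" using assms by simp
  then have "Max ?S \<in> ?S" using fin Max_in by blast
  then show ?thesis using fin by (intro exI[of _ "Max ?S"]) auto
qed

text \<open>\<open>Q\<close> is the least common multiple of the numbers up to \<open>n\<close>:
  each prime enters with its largest power not exceeding \<open>n\<close>, so every factor is at
  most \<open>n\<close>.\<close>

lemma common_multiple_le_power_primes:
  fixes n :: nat
  assumes "n > 0"
  shows "\<exists>Q>0. (\<forall>m. 0 < m \<longrightarrow> m \<le> n \<longrightarrow> m dvd Q) \<and> Q \<le> n ^ card {p. prime p \<and> p \<le> n}"
proof -
  let ?P = "{p. prime p \<and> p \<le> n}"
  have fin: "finite ?P" by simp
  obtain e where e: "\<And>p. prime p \<Longrightarrow> p ^ e p \<le> n" "\<And>p k. prime p \<Longrightarrow> p ^ k \<le> n \<Longrightarrow> k \<le> e p"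
    using prime_power_bound_ex[OF assms] by metis
  define Q where "Q = (\<Prod>p\<in>?P. p ^ e p)"
  have Q0: "Q > 0" unfolding Q_def by (intro prod_pos) (auto simp: prime_gt_0_nat)
  have "m dvd Q" if m: "0 < m" "m \<le> n" for m
  proof (rule multiplicity_le_imp_dvd)
    show "m \<noteq> 0" using m by simp
    fix p :: nat assume p: "prime p"
    have dm: "p ^ multiplicity p m dvd m" by (rule multiplicity_dvd)
    then have le: "p ^ multiplicity p m \<le> n" using m dvd_imp_le[OF dm] by linarith
    show "multiplicity p m \<le> multiplicity p Q"
    proof (cases "p \<le> n")
      case True
      have "p ^ e p dvd Q" unfolding Q_def using True p fin by (intro dvd_prodI) auto
      then have "p ^ multiplicity p m dvd Q"
        using e(2)[OF p le] le_imp_power_dvd dvd_trans by blast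
      then show ?thesis
        using Q0 p by (intro multiplicity_geI) (auto simp: prime_elem_not_unit)
    next
      case False
      then have "\<not> p dvd m" using m dvd_imp_le[of p m] by linarith
      then show ?thesis by (simp add: not_dvd_imp_multiplicity_0)
    qed
  qed
  moreover have "Q \<le> n ^ card ?P"
    unfolding Q_def using prod_mono[of ?P "\<lambda>p. p ^ e p" "\<lambda>_. n"] e(1) by auto
  ultimately show ?thesis using Q0 by blast
qed

text \<open>The entries \<open>1 / (k * (n choose k))\<close> of Leibniz's harmonic triangle are differences of
  entries of the preceding column, so they are integral combinations of \<open>1, 1/2, \<dots>, 1/n\<close>.\<close>

lemma leibniz_triangle_aux:
  fixes k n u v w :: real
  assumes "k * w = n * u" "k * w = (n - k) * v" "k > 0" "n > 0" "u > 0" "v > 0" "w > 0"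
  shows "1 / w = 1 / u - 1 / v"
proof -
  have "1 / u = n / (k * w)" "1 / v = (n - k) / (k * w)"
    using assms by (simp_all add: field_simps)
  then have "1 / u - 1 / v = k / (k * w)" by (simp add: diff_divide_distrib[symmetric])
  then show ?thesis using assms(3,7) by simp
qed

lemma mult_binomial_dvd_common_multiple:
  fixes Q N :: nat
  assumes "\<And>m. 0 < m \<Longrightarrow> m \<le> N \<Longrightarrow> m dvd Q"
  shows "0 < k \<Longrightarrow> k \<le> n \<Longrightarrow> n \<le> N \<Longrightarrow> k * (n choose k) dvd Q"
proof (induction k arbitrary: n rule: nat_induct)
  case (Suc k)
  show ?case
  proof (cases "k = 0")
    case True
    then show ?thesis using Suc assms[of n] by simp
  next
    case False
    let ?u = "k * ((n - 1) choose k)" and ?v = "k * (n choose k)" and ?w = "Suc k * (n choose Suc k)"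
    \<comment> \<open>The induction hypothesis for column \<open>k\<close> is used in rows
      \<open>n - 1\<close> and \<open>n\<close>; the former is admissible because
      \<open>Suc k \<le> n\<close>.\<close>
    from Suc False obtain x y where x: "Q = ?u * x" and y: "Q = ?v * y"
      by (metis Suc_le_D Suc_le_mono diff_Suc_1 dvd_def gr0I le_SucI)
    have pos: "?u > 0" "?v > 0" "?w > 0" using Suc False by auto
    have w: "?w = n * ((n - 1) choose k)" "?w = (n - k) * (n choose k)"
      using binomial_absorption[of k n] binomial_absorb_comp[of n k] by simp_all
    have "real k * real ?w = real n * real ?u" unfolding w(1) by simp
    moreover have "real k * real ?w = (real n - real k) * real ?v"
      using Suc.prems unfolding w(2) by (simp add: of_nat_diff)
    ultimately have "1 / real ?w = 1 / real ?u - 1 / real ?v"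
      using pos False Suc.prems by (intro leibniz_triangle_aux[of "real k" _ "real n"]) (simp_all only: of_nat_0_less_iff)
    then have "real Q * (1 / real ?u - 1 / real ?v) = real Q * (1 / real ?w)" by (rule arg_cong[OF sym])
    then have "real Q / real ?u - real Q / real ?v = real Q / real ?w"
      by (simp only: right_diff_distrib times_divide_eq_right mult_1_right)
    then have "real Q = real ?w * (real Q / real ?u - real Q / real ?v)"
      using pos(3) by (simp only: of_nat_0_less_iff[symmetric, where 'a=real] nonzero_mult_div_cancel_left times_divide_eq_right less_irrefl simp_thms)
    also have "real Q / real ?u = real x" using x pos by (simp add: field_simps)
    also have "real Q / real ?v = real y" using y pos by (simp add: field_simps)
    finally have "of_int (int Q) = (of_int (int ?w * (int x - int y)) :: real)" by simp
    then have "int Q = int ?w * (int x - int y)" by (simp only: of_int_eq_iff)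
    then have "int ?w dvd int Q" by simp
    then show ?thesis by (simp only: int_dvd_int_iff)
  qed
qed simp

text \<open>Nair's argument: with \<open>n = 2 ^ (m - 1)\<close>, the number
  \<open>n * ((2 * n) choose n)\<close> divides every common multiple of the numbers up to
  \<open>2 * n\<close>. The factor \<open>n\<close> compensates the denominator of
  \<open>4 ^ n / (2 * n)\<close>, so such a multiple is at least
  \<open>2 ^ (2 ^ m - 1)\<close>.\<close>

lemma card_primes_le_power2_lower:
  "2 ^ m \<le> m * card {p::nat. prime p \<and> p \<le> 2 ^ m} + 1"
proof (cases m)
  case (Suc i)
  let ?n = "2 ^ i :: nat" and ?c = "card {p::nat. prime p \<and> p \<le> 2 ^ m}"
  obtain Q :: nat where Q: "Q > 0" "\<And>k. 0 < k \<Longrightarrow> k \<le> 2 ^ m \<Longrightarrow> k dvd Q" "Q \<le> (2 ^ m) ^ ?c"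
    using common_multiple_le_power_primes[of "2 ^ m"] by auto
  have "?n * ((2 * ?n) choose ?n) dvd Q"
    by (rule mult_binomial_dvd_common_multiple[OF Q(2)]) (auto simp: Suc)
  then have "?n * ((2 * ?n) choose ?n) \<le> Q" using Q(1) by (rule dvd_imp_le)
  with Q(3) have le: "?n * ((2 * ?n) choose ?n) \<le> 2 ^ (m * ?c)" by (simp add: power_mult)
  have "4 ^ ?n / (2 * real ?n) \<le> real ((2 * ?n) choose ?n)"
    by (rule central_binomial_lower_bound) simp
  then have "(4::real) ^ ?n \<le> 2 * real (?n * ((2 * ?n) choose ?n))"
    by (simp add: field_simps)
  also have "\<dots> \<le> 2 * real (2 ^ (m * ?c))" using le by (simp only: of_nat_le_iff mult_le_cancel_left_pos zero_less_numeral)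
  finally have "(4::real) ^ ?n \<le> 2 ^ (m * ?c + 1)" by simp
  moreover have "(4::real) ^ ?n = 2 ^ (2 ^ m)" using Suc by (simp add: power_mult)
  ultimately have "(2::real) ^ (2 ^ m) \<le> 2 ^ (m * ?c + 1)" by simp
  then show ?thesis by (simp only: power_increasing_iff)
qed simp

lemma card_primes_le_power2_step:
  "card {p::nat. prime p \<and> p \<le> 2 ^ Suc i} = card {p::nat. prime p \<and> p \<le> 2 ^ i} + card (dyadic_primes i)"
proof -
  have "{p::nat. prime p \<and> p \<le> 2 ^ Suc i} = {p. prime p \<and> p \<le> 2 ^ i} \<union> dyadic_primes i"
    by (auto simp: dyadic_primes_def)
  then show ?thesis by (simp add: card_Un_disjoint dyadic_primes_def disjoint_iff)
qed

lemma card_primes_le_power2_upper: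
  assumes "m \<ge> 1"
  shows "real m * real (card {p::nat. prime p \<and> p \<le> 2 ^ m}) \<le> 4 * 2 ^ m"
proof -
  have "{p::nat. prime p \<and> p \<le> 2 ^ 1} = {2}" by (auto dest: prime_ge_2_nat)
  then have c1: "card {p::nat. prime p \<and> p \<le> 2 ^ 1} = 1" by simp
  have d1: "card (dyadic_primes 1) \<le> 4" "card (dyadic_primes 2) \<le> 4"
    using card_dyadic_primes[of 1] card_dyadic_primes[of 2] by auto
  have c2: "card {p::nat. prime p \<and> p \<le> 2 ^ 2} \<le> 5"
    using card_primes_le_power2_step[of 1] d1 c1 by (simp add: numeral_2_eq_2)
  have c3: "card {p::nat. prime p \<and> p \<le> 2 ^ 3} \<le> 9"
    using card_primes_le_power2_step[of 2] d1 c2 by (simp add: eval_nat_numeral)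
  \<comment> \<open>The inductive step needs \<open>6 * (m + 1) \<le> 8 * m\<close>, which holds
    from \<open>m = 3\<close> on; smaller cases rest on direct counts.\<close>
  consider "m = 1" | "m = 2" | "m \<ge> 3" using assms by linarith
  then show ?thesis
  proof cases
    case 3
    then show ?thesis
    proof (induction m rule: nat_induct_at_least)
      case base
      then show ?case using c3 by simp
    next
      case (Suc m)
      let ?c = "real (card {p::nat. prime p \<and> p \<le> 2 ^ m})" and ?d = "real (card (dyadic_primes m))"
      have d: "real m * ?d \<le> 2 * 2 ^ m"
        using card_dyadic_primes[of m] by (metis of_nat_le_iff of_nat_mult of_nat_numeral of_nat_power power_Suc)
      have "real m * (real (Suc m) * (?c + ?d)) = real (Suc m) * (real m * ?c + real m * ?d)"
        by (simp add: algebra_simps)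
      also have "\<dots> \<le> real (Suc m) * (6 * 2 ^ m)"
        using Suc.IH d by (intro mult_left_mono) auto
      also have "\<dots> = (6 * real m + 6) * 2 ^ m" by (simp add: algebra_simps)
      also have "\<dots> \<le> (8 * real m) * 2 ^ m" using Suc.hyps by (intro mult_right_mono) auto
      also have "\<dots> = real m * (4 * 2 ^ Suc m)" by simp
      finally have "real (Suc m) * (?c + ?d) \<le> 4 * 2 ^ Suc m"
        using Suc.hyps by (simp only: mult_le_cancel_left_pos of_nat_0_less_iff)
      then show ?case using card_primes_le_power2_step[of m] by simp
    qed
  qed (use c1 c2 in auto)
qed

section \<open>Sums over primes at powers of two\<close>

lemma real_card_dyadic_primes: "i \<ge> 1 \<Longrightarrow> real (card (dyadic_primes i)) \<le> 2 * 2 ^ i / real i"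
proof -
  assume i: "i \<ge> 1"
  have "real (i * card (dyadic_primes i)) \<le> real (2 ^ Suc i)"
    using card_dyadic_primes[of i] by (simp only: of_nat_le_iff)
  then show ?thesis using i by (simp add: field_simps)
qed

text \<open>The subtracted \<open>1 / 2 ^ M\<close> makes the induction telescope: the next block
  contributes at most \<open>2 / (m * 2 ^ M)\<close>, which is \<open>4 / m\<close> times the drop
  from \<open>1 / 2 ^ M\<close> to \<open>1 / 2 ^ Suc M\<close>.\<close>

lemma sum_primes_between_powers2:
  assumes "1 \<le> m" "m \<le> M"
  shows "(\<Sum>p | prime p \<and> 2 ^ m < p \<and> p \<le> (2::nat) ^ M. 1 / real p ^ 2)
           \<le> 4 / real m * (1 / 2 ^ m - 1 / 2 ^ M)"
  using assms(2)
proof (induction M rule: nat_induct_at_least)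
  case base
  have "{p. prime p \<and> 2 ^ m < p \<and> p \<le> (2::nat) ^ m} = {}" by auto
  then show ?case by (simp only: sum.empty) simp
next
  case (Suc M)
  have le: "(2::nat) ^ m \<le> 2 ^ M" using Suc.hyps by (intro power_increasing) auto
  have eq: "{p. prime p \<and> 2 ^ m < p \<and> p \<le> (2::nat) ^ Suc M}
      = {p. prime p \<and> 2 ^ m < p \<and> p \<le> (2::nat) ^ M} \<union> dyadic_primes M"
    using le by (auto simp: dyadic_primes_def simp del: power_increasing_iff intro: le_less_trans)
  have "(\<Sum>p\<in>dyadic_primes M. 1 / real p ^ 2) \<le> real (card (dyadic_primes M)) * (1 / (2 ^ M) ^ 2)"
  proof (intro sum_bounded_above divide_left_mono power_mono)
    fix p assume "p \<in> dyadic_primes M"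
    then have "2 ^ M \<le> p" by (simp add: dyadic_primes_def)
    then show "2 ^ M \<le> real p" by (metis of_nat_le_iff of_nat_numeral of_nat_power)
    then show "0 < (real p)\<^sup>2 * (2 ^ M)\<^sup>2"
      using zero_less_power[of "2::real" M] by (intro mult_pos_pos zero_less_power) linarith+
  qed auto
  also have "\<dots> \<le> (2 * 2 ^ M / real M) * (1 / (2 ^ M) ^ 2)"
    using Suc.hyps assms(1) by (intro mult_right_mono real_card_dyadic_primes) auto
  also have "\<dots> = 2 / real M * (1 / 2 ^ M)" by (simp add: power2_eq_square)
  also have "\<dots> \<le> 2 / real m * (1 / 2 ^ M)"
    using Suc.hyps assms(1) by (intro mult_right_mono divide_left_mono) auto
  also have "\<dots> = 4 / real m * (1 / 2 ^ M - 1 / 2 ^ Suc M)" by (simp add: field_simps)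
  finally have d: "(\<Sum>p\<in>dyadic_primes M. 1 / real p ^ 2) \<le> 4 / real m * (1 / 2 ^ M - 1 / 2 ^ Suc M)" .
  have "(\<Sum>p | prime p \<and> 2 ^ m < p \<and> p \<le> (2::nat) ^ Suc M. 1 / real p ^ 2)
     = (\<Sum>p | prime p \<and> 2 ^ m < p \<and> p \<le> (2::nat) ^ M. 1 / real p ^ 2) + (\<Sum>p\<in>dyadic_primes M. 1 / real p ^ 2)"
    unfolding eq by (rule sum.union_disjoint) (auto simp: dyadic_primes_def)
  also have "\<dots> \<le> 4 / real m * (1 / 2 ^ m - 1 / 2 ^ M) + 4 / real m * (1 / 2 ^ M - 1 / 2 ^ Suc M)"
    by (rule add_mono[OF Suc.IH d])
  also have "\<dots> = 4 / real m * (1 / 2 ^ m - 1 / 2 ^ Suc M)" by (simp add: algebra_simps)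
  finally show ?case .
qed

text \<open>The upper half of Mertens' estimate. The term \<open>- 2 / M\<close> absorbs the next
  dyadic block, and its successor is recovered from
  \<open>1 / (M + 1) \<le> ln (M + 1) - ln M\<close>.\<close>

lemma sum_inverse_primes_le_power2:
  assumes "M \<ge> 1"
  shows "(\<Sum>p | prime p \<and> p \<le> (2::nat) ^ M. 1 / real p) \<le> 5 + 2 * ln (real M) - 2 / real M"
  using assms
proof (induction M rule: nat_induct_at_least)
  case base
  have "{p::nat. prime p \<and> p \<le> 2} = {2}" by (auto dest: prime_ge_2_nat)
  then show ?case by simp
next
  case (Suc M)
  have eq: "{p. prime p \<and> p \<le> (2::nat) ^ Suc M} = {p. prime p \<and> p \<le> (2::nat) ^ M} \<union> dyadic_primes M"
    by (auto simp: dyadic_primes_def)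
  have "(\<Sum>p\<in>dyadic_primes M. 1 / real p) \<le> real (card (dyadic_primes M)) * (1 / 2 ^ M)"
  proof (intro sum_bounded_above divide_left_mono)
    fix p assume "p \<in> dyadic_primes M"
    then have "2 ^ M \<le> p" by (simp add: dyadic_primes_def)
    then show "2 ^ M \<le> real p" by (metis of_nat_le_iff of_nat_numeral of_nat_power)
    then show "0 < real p * 2 ^ M"
      using zero_less_power[of "2::real" M] by (intro mult_pos_pos) linarith+
  qed auto
  also have "\<dots> \<le> (2 * 2 ^ M / real M) * (1 / 2 ^ M)"
    using Suc.hyps by (intro mult_right_mono real_card_dyadic_primes) auto
  finally have d: "(\<Sum>p\<in>dyadic_primes M. 1 / real p) \<le> 2 / real M" by simp
  have "ln (real M / real (Suc M)) \<le> real M / real (Suc M) - 1"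
    using Suc.hyps by (intro ln_le_minus_one) auto
  also have "\<dots> = - (1 / real (Suc M))" by (simp add: field_simps)
  finally have l: "1 / real (Suc M) \<le> ln (real (Suc M)) - ln (real M)"
    using Suc.hyps by (simp add: ln_div)
  have "(\<Sum>p | prime p \<and> p \<le> (2::nat) ^ Suc M. 1 / real p)
     = (\<Sum>p | prime p \<and> p \<le> (2::nat) ^ M. 1 / real p) + (\<Sum>p\<in>dyadic_primes M. 1 / real p)"
    unfolding eq by (rule sum.union_disjoint) (auto simp: dyadic_primes_def)
  also have "\<dots> \<le> (5 + 2 * ln (real M) - 2 / real M) + 2 / real M"
    by (rule add_mono[OF Suc.IH d])
  also have "\<dots> \<le> 5 + 2 * ln (real (Suc M)) - 2 * (1 / real (Suc M))" using l by linarith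
  finally show ?case by simp
qed

section \<open>Chebyshev bounds at real thresholds\<close>

lemma dyadic_bracket:
  fixes t :: real
  assumes "t \<ge> 2"
  obtains m where "m \<ge> 1" "2 ^ m \<le> t" "t < 2 ^ (m + 1)" "ln t \<le> real (m + 1)" "real (m + 1) \<le> 4 * ln t"
proof -
  define m where "m = nat \<lfloor>log 2 t\<rfloor>"
  have l1: "log 2 t \<ge> 1" using assms by (simp add: le_log_iff)
  then have m: "real m \<le> log 2 t" "log 2 t < real m + 1" "m \<ge> 1"
    unfolding m_def by linarith+
  have "2 powr real m \<le> t" "t < 2 powr (real m + 1)"
    using m assms by (simp_all add: le_log_iff log_less_iff)
  then have p: "2 ^ m \<le> t" "t < 2 ^ (m + 1)"
    using powr_realpow[of 2 "m + 1"] by (simp_all add: powr_realpow add.commute)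
  \<comment> \<open>These crude bounds on \<open>ln 2\<close>, together with
    \<open>m + 1 \<le> 2 * m\<close>, give the factor 4.\<close>
  have l2: "1 / 2 \<le> ln (2::real)" "ln (2::real) \<le> 1" using ln2_ge_two_thirds ln_2_less_1 by auto
  have "ln t < ln (2 ^ (m + 1))" using p(2) assms by (subst ln_less_cancel_iff) auto
  also have "\<dots> = real (m + 1) * ln 2" by (rule ln_realpow)
  also have "\<dots> \<le> real (m + 1) * 1" using l2 by (intro mult_left_mono) auto
  finally have a: "ln t \<le> real (m + 1)" by simp
  have "real (m + 1) \<le> 4 * (real m * (1 / 2))" using m(3) by simp
  also have "\<dots> \<le> 4 * (real m * ln 2)" using l2 by (intro mult_left_mono) auto
  also have "real m * ln 2 = ln (2 ^ m)" by (rule ln_realpow[symmetric])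
  also have "\<dots> \<le> ln t" using p(1) assms by (subst ln_le_cancel_iff) auto
  finally show ?thesis using that m(3) p a by simp
qed

lemma sum_inverse_squares_primes_gt_upper:
  fixes t :: real
  assumes t: "t \<ge> 2" and A: "finite A" "\<And>p. p \<in> A \<Longrightarrow> prime p \<and> t < real p"
  shows "(\<Sum>p\<in>A. 1 / real p ^ 2) \<le> 16 / (t * ln t)"
proof -
  obtain m where m: "m \<ge> 1" "2 ^ m \<le> t" "t < 2 ^ (m + 1)" "ln t \<le> real (m + 1)"
    using dyadic_bracket[OF t] by metis
  obtain n where n: "\<And>p. p \<in> A \<Longrightarrow> p \<le> n" using A(1) by (meson finite_nat_set_iff_bounded_le)
  define M where "M = max m n"
  have "n < 2 ^ n" by (rule less_exp)
  also have "\<dots> \<le> 2 ^ M" unfolding M_def by (intro power_increasing) auto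
  finally have nM: "n \<le> 2 ^ M" by simp
  have sub: "A \<subseteq> {p. prime p \<and> 2 ^ m < p \<and> p \<le> 2 ^ M}"
  proof safe
    fix p assume p: "p \<in> A"
    show "prime p" using A(2)[OF p] by simp
    have "(2::real) ^ m < real p" using A(2)[OF p] m(2) by linarith
    then show "2 ^ m < p" by (metis of_nat_less_iff of_nat_numeral of_nat_power)
    show "p \<le> 2 ^ M" using n[OF p] nM by simp
  qed
  have "(\<Sum>p\<in>A. 1 / real p ^ 2) \<le> (\<Sum>p | prime p \<and> 2 ^ m < p \<and> p \<le> (2::nat) ^ M. 1 / real p ^ 2)"
    using sub by (intro sum_mono2) auto
  also have "\<dots> \<le> 4 / real m * (1 / 2 ^ m - 1 / 2 ^ M)"
    using m(1) by (intro sum_primes_between_powers2) (auto simp: M_def)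
  also have "\<dots> \<le> 4 / real m * (1 / 2 ^ m)" by (intro mult_left_mono) auto
  also have "\<dots> = 4 / (real m * 2 ^ m)" by simp
  \<comment> \<open>\<open>m \<ge> ln t / 2\<close> because \<open>m + 1 \<le> 2 * m\<close>, and
    \<open>2 ^ m > t / 2\<close>.\<close>
  also have "\<dots> \<le> 4 / ((ln t / 2) * (t / 2))"
    using m t by (intro divide_left_mono mult_mono mult_pos_pos) (auto simp: field_simps)
  finally show ?thesis by (simp add: field_simps)
qed

lemma card_primes_le_upper:
  fixes t :: real
  assumes t: "t \<ge> 2"
  shows "real (card {p. prime p \<and> real p \<le> t}) \<le> 8 * t / ln t"
proof -
  obtain m where m: "m \<ge> 1" "2 ^ m \<le> t" "t < 2 ^ (m + 1)" "ln t \<le> real (m + 1)"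
    using dyadic_bracket[OF t] by metis
  have sub: "{p. prime p \<and> real p \<le> t} \<subseteq> {p. prime p \<and> p \<le> 2 ^ (m + 1)}"
  proof safe
    fix p assume "real p \<le> t"
    then have "real p < 2 ^ (m + 1)" using m(3) by linarith
    then show "p \<le> 2 ^ (m + 1)" by (metis less_imp_le of_nat_less_iff of_nat_numeral of_nat_power)
  qed
  have "ln t * real (card {p. prime p \<and> real p \<le> t}) \<le> real (m + 1) * real (card {p::nat. prime p \<and> p \<le> 2 ^ (m + 1)})"
    using sub m t by (intro mult_mono) (auto intro!: card_mono)
  also have "\<dots> \<le> 4 * 2 ^ (m + 1)" by (rule card_primes_le_power2_upper) simp
  also have "\<dots> \<le> 8 * t" using m(2) by simp
  finally show ?thesis using t by (simp add: field_simps)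
qed

lemma sum_inverse_primes_le_upper:
  fixes t :: real
  assumes t: "t \<ge> 2"
  shows "(\<Sum>p | prime p \<and> real p \<le> t. 1 / real p) \<le> 5 + 2 * ln (4 * ln t)"
proof -
  obtain m where m: "m \<ge> 1" "2 ^ m \<le> t" "t < 2 ^ (m + 1)" "real (m + 1) \<le> 4 * ln t"
    using dyadic_bracket[OF t] by metis
  have sub: "{p. prime p \<and> real p \<le> t} \<subseteq> {p. prime p \<and> p \<le> 2 ^ (m + 1)}"
  proof safe
    fix p assume "real p \<le> t"
    then have "real p < 2 ^ (m + 1)" using m(3) by linarith
    then show "p \<le> 2 ^ (m + 1)" by (metis less_imp_le of_nat_less_iff of_nat_numeral of_nat_power)
  qed
  have "(\<Sum>p | prime p \<and> real p \<le> t. 1 / real p) \<le> (\<Sum>p | prime p \<and> p \<le> (2::nat) ^ (m + 1). 1 / real p)"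
    using sub by (intro sum_mono2) auto
  also have "\<dots> \<le> 5 + 2 * ln (real (m + 1)) - 2 / real (m + 1)"
    by (rule sum_inverse_primes_le_power2) simp
  also have "\<dots> \<le> 5 + 2 * ln (real (m + 1))" by simp
  also have "ln (real (m + 1)) \<le> ln (4 * ln t)" using m(4) by (subst ln_le_cancel_iff) auto
  finally show ?thesis by simp
qed

text \<open>The upper and lower Chebyshev constants differ, so a single dyadic block might contain
  no counted primes; four blocks suffice. For \<open>i \<ge> 4\<close>, which
  \<open>t \<ge> 8\<close> guarantees, \<open>i + 4 \<le> 2 * i\<close>, so \<open>i\<close> times
  the prime count at \<open>2 ^ (i + 4)\<close> is about \<open>8 * 2 ^ i\<close>, against at most
  \<open>4 * 2 ^ i\<close> at \<open>2 ^ i\<close>. The window ends at \<open>32 * t\<close> because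
  \<open>2 ^ i \<le> 2 * t\<close>.\<close>

lemma sum_inverse_squares_primes_gt_lower:
  fixes t :: real
  assumes t: "t \<ge> 8"
  shows "1 / (1024 * (t * ln t)) \<le> (\<Sum>p | prime p \<and> t < real p \<and> real p \<le> 32 * t. 1 / real p ^ 2)"
proof -
  obtain m where m: "m \<ge> 1" "2 ^ m \<le> t" "t < 2 ^ (m + 1)" "real (m + 1) \<le> 4 * ln t"
    using dyadic_bracket[of t] t by auto
  define i where "i = m + 1"
  have "(2::real) ^ 3 < 2 ^ i" using m(3) t unfolding i_def by simp
  then have i4: "i \<ge> 4" by (simp only: power_strict_increasing_iff)
  let ?\<pi> = "\<lambda>j. card {p::nat. prime p \<and> p \<le> 2 ^ j}"
  let ?S = "{p::nat. prime p \<and> 2 ^ i < p \<and> p \<le> 2 ^ (i + 4)}"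
  have fin: "finite ?S" by (rule finite_subset[of _ "{..2 ^ (i+4)}"]) auto
  have mono: "(2::nat) ^ i \<le> 2 ^ (i + 4)" by (intro power_increasing) auto
  have un: "{p::nat. prime p \<and> p \<le> 2 ^ (i+4)} = {p. prime p \<and> p \<le> 2 ^ i} \<union> ?S"
    using mono by (auto intro: order_trans)
  have "?\<pi> (i + 4) = ?\<pi> i + card ?S"
    unfolding un using fin by (intro card_Un_disjoint) auto
  then have cS: "real (card ?S) = real (?\<pi> (i + 4)) - real (?\<pi> i)" by simp
  have "real (2 ^ (i + 4)) \<le> real ((i + 4) * ?\<pi> (i + 4) + 1)"
    using card_primes_le_power2_lower[of "i + 4"] by (simp only: of_nat_le_iff)
  then have lo: "16 * 2 ^ i - 1 \<le> real (i + 4) * real (?\<pi> (i + 4))" by (simp add: power_add algebra_simps)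
  also have "\<dots> \<le> (2 * real i) * real (?\<pi> (i + 4))" using i4 by (intro mult_right_mono) auto
  finally have lo: "16 * 2 ^ i - 1 \<le> 2 * (real i * real (?\<pi> (i + 4)))" by (simp add: mult_ac)
  have up: "real i * real (?\<pi> i) \<le> 4 * 2 ^ i" using i4 by (intro card_primes_le_power2_upper) simp
  have "(1::real) \<le> 2 ^ i" by (rule one_le_power) simp
  then have card: "3 * 2 ^ i \<le> real i * real (card ?S)"
    using lo up unfolding cS right_diff_distrib by linarith
  have p2: "2 ^ i \<le> 2 * t" using m(2) unfolding i_def by simp
  have lnt: "ln t > 0" using t by simp
  have "1 / (1024 * (t * ln t)) \<le> 3 / (256 * ((2 * t) * (4 * ln t)))" using t lnt by (simp add: field_simps)
  also have "\<dots> \<le> 3 / (256 * (2 ^ i * real i))"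
    using p2 m(4) i4 t lnt by (intro divide_left_mono mult_left_mono mult_mono mult_pos_pos) (auto simp: i_def)
  also have "\<dots> = (3 * 2 ^ i / real i) * (1 / (2 ^ (i + 4)) ^ 2)"
    using i4 by (simp add: power_add power2_eq_square)
  also have "\<dots> \<le> real (card ?S) * (1 / (2 ^ (i + 4)) ^ 2)"
    using card i4 by (intro mult_right_mono) (auto simp: field_simps)
  also have "\<dots> \<le> (\<Sum>p\<in>?S. 1 / real p ^ 2)"
  proof (intro sum_bounded_below divide_left_mono power_mono)
    fix p assume p: "p \<in> ?S"
    then have "p \<le> 2 ^ (i + 4)" "p > 0" by (auto simp: prime_gt_0_nat)
    then show "real p \<le> 2 ^ (i + 4)" "0 < (2 ^ (i + 4))\<^sup>2 * (real p)\<^sup>2"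
      by (metis of_nat_le_iff of_nat_numeral of_nat_power) (simp add: \<open>p > 0\<close>)
  qed auto
  also have "\<dots> \<le> (\<Sum>p | prime p \<and> t < real p \<and> real p \<le> 32 * t. 1 / real p ^ 2)"
  proof (intro sum_mono2)
    show "finite {p. prime p \<and> t < real p \<and> real p \<le> 32 * t}"
      by (rule finite_subset[of _ "{..nat \<lceil>32 * t\<rceil>}"]) (auto, linarith)
    show "?S \<subseteq> {p. prime p \<and> t < real p \<and> real p \<le> 32 * t}"
    proof safe
      fix p :: nat assume p: "2 ^ i < p" "p \<le> 2 ^ (i + 4)"
      have "(2::real) ^ i < real p" "real p \<le> 2 ^ (i + 4)"
        using p by (metis of_nat_less_iff of_nat_le_iff of_nat_numeral of_nat_power)+
      then show "t < real p" "real p \<le> 32 * t"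
        using m(3) p2 by (auto simp: i_def power_add)
    qed
  qed auto
  finally show ?thesis .
qed

section \<open>The Markov chain of continued fraction digits\<close>

lemma gauss_map_measurable [measurable]: "gauss_map \<in> borel_measurable borel"
  unfolding gauss_map_def by measurable

lemma gauss_map_funpow_measurable [measurable]: "(gauss_map ^^ n) \<in> borel_measurable borel"
proof (induction n)
  case (Suc n)
  then show ?case unfolding funpow.simps by (rule measurable_comp) measurable
qed simp

lemma cf_digit_measurable [measurable]: "cf_digit n \<in> measurable borel (count_space UNIV)"
  unfolding cf_digit_def by measurable

lemma cf_digit_Suc: "n \<ge> 1 \<Longrightarrow> cf_digit (Suc n) x = cf_digit n (gauss_map x)"
  by (cases n) (simp_all add: cf_digit_def funpow_swap1)

lemma gauss_map_branch:
  assumes "0 \<le> t" "t < 1"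
  shows "gauss_map (1 / (real j + t)) = t" and "cf_digit 1 (1 / (real j + t)) = j"
proof -
  have "\<lfloor>real j + t\<rfloor> = int j" using assms by linarith
  then show "gauss_map (1 / (real j + t)) = t" "cf_digit 1 (1 / (real j + t)) = j"
    by (simp_all add: gauss_map_def cf_digit_def)
qed

text \<open>With \<open>s = q\<^sub>n\<^sub>-\<^sub>1 / q\<^sub>n\<close> this is the density of the \<open>n\<close>-th iterate of the Gauss map conditioned on
  the first \<open>n\<close> digits, where \<open>q\<^sub>n\<close> are the denominators of the convergents.\<close>

definition cf_density :: "real \<Rightarrow> real \<Rightarrow> real" where
  "cf_density s x = (1 + s) / (1 + s * x)\<^sup>2"

definition cf_measure :: "real \<Rightarrow> real measure" where
  "cf_measure s = density lborel (\<lambda>x. ennreal (cf_density s x) * indicator {0<..<1} x)"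

definition cf_prob :: "real \<Rightarrow> nat \<Rightarrow> real" where
  "cf_prob s j = (1 + s) / ((real j + s) * (real j + s + 1))"

lemma cf_density_measurable [measurable]: "cf_density s \<in> borel_measurable borel"
  unfolding cf_density_def by measurable

lemma sets_cf_measure [simp, measurable_cong]: "sets (cf_measure s) = sets borel"
  and space_cf_measure [simp]: "space (cf_measure s) = UNIV"
  by (simp_all add: cf_measure_def)

lemma nn_integral_cf_measure:
  assumes [measurable]: "F \<in> borel_measurable borel"
  shows "(\<integral>\<^sup>+x. F x \<partial>cf_measure s)
    = (\<integral>\<^sup>+x. F x * ennreal (cf_density s x) * indicator {0<..<1} x \<partial>lborel)"
  unfolding cf_measure_def by (subst nn_integral_density) (simp_all add: mult_ac)

lemma AE_lborel_neq: "AE x in lborel. x \<noteq> (a::real)"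
  by (rule AE_I[of _ _ "{a}"]) auto

lemma emeasure_cf_measure_UNIV:
  assumes "0 \<le> s"
  shows "emeasure (cf_measure s) UNIV = 1"
proof -
  have "emeasure (cf_measure s) UNIV = (\<integral>\<^sup>+x. 1 \<partial>cf_measure s)"
    using nn_integral_const[of "cf_measure s" 1] by simp
  also have "\<dots> = (\<integral>\<^sup>+x. ennreal (cf_density s x) * indicator {0<..<1} x \<partial>lborel)"
    by (subst nn_integral_cf_measure) simp_all
  also have "\<dots> = (\<integral>\<^sup>+x. ennreal (cf_density s x) * indicator {0..1} x \<partial>lborel)"
    using AE_lborel_neq[of 0] AE_lborel_neq[of 1]
    by (intro nn_integral_cong_AE) (auto split: split_indicator)
  also have "\<dots> = ennreal ((1 + s) * 1 / (1 + s * 1)) - ennreal ((1 + s) * 0 / (1 + s * 0))"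
  proof (subst nn_integral_FTC_Icc[where F = "\<lambda>x. (1 + s) * x / (1 + s * x)"])
    fix x :: real assume "x \<in> {0..1}"
    then have p: "1 + s * x > 0" using assms by (simp add: add_pos_nonneg)
    show "((\<lambda>x. (1 + s) * x / (1 + s * x)) has_real_derivative cf_density s x) (at x)"
      unfolding cf_density_def using p
      by (auto intro!: derivative_eq_intros simp: power2_eq_square field_simps)
    show "0 \<le> cf_density s x" unfolding cf_density_def using assms by simp
  qed (use assms in simp_all)
  also have "\<dots> = 1" using assms by simp
  finally show ?thesis .
qed

text \<open>Both sides equal \<open>(1 + s) / (j + s + t)\<^sup>2\<close>. The left side is the
  density pulled back along the inverse branch \<open>1 / (j + t)\<close> with its Jacobian; this
  closure of the family under conditioning on a digit is what singles out these densities.\<close>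

lemma cf_density_branch:
  assumes "0 \<le> s" "j \<ge> 1" "0 \<le> t"
  shows "cf_density s (1 / (real j + t)) / (real j + t)\<^sup>2 = cf_prob s j * cf_density (1 / (real j + s)) t"
proof -
  have p: "real j + t > 0" "real j + s > 0" "real j + s + t > 0" using assms by linarith+
  have a: "1 + s * (1 / (real j + t)) = (real j + s + t) / (real j + t)" using p by (simp add: field_simps)
  have b: "1 + 1 / (real j + s) * t = (real j + s + t) / (real j + s)" using p by (simp add: field_simps)
  have c: "1 + 1 / (real j + s) = (real j + s + 1) / (real j + s)" using p by (simp add: field_simps)
  have "cf_density s (1 / (real j + t)) / (real j + t)\<^sup>2 = (1 + s) / (real j + s + t)\<^sup>2"
    unfolding cf_density_def a using p by (simp add: power_divide)
  also have "\<dots> = cf_prob s j * cf_density (1 / (real j + s)) t"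
    unfolding cf_density_def cf_prob_def b c using p by (simp add: power_divide power2_eq_square)
  finally show ?thesis .
qed

lemma nn_integral_branch:
  assumes s: "0 \<le> s" and j: "j \<ge> 1" and [measurable]: "F \<in> borel_measurable borel"
  shows "(\<integral>\<^sup>+x. F x * ennreal (cf_density s x) * indicator {1 / (real j + 1)..1 / real j} x \<partial>lborel)
     = ennreal (cf_prob s j) *
       (\<integral>\<^sup>+t. F (1 / (real j + t)) * ennreal (cf_density (1 / (real j + s)) t) * indicator {0..1} t \<partial>lborel)"
proof -
  \<comment> \<open>The inverse branch is decreasing; with \<open>u = 1 - t\<close> the substitution
    has a nonnegative derivative, and the reflection is undone afterwards.\<close>
  define g where "g u = 1 / (real j + 1 - u)" for u :: real
  define g' where "g' u = 1 / (real j + 1 - u)\<^sup>2" for u :: real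
  have "(\<integral>\<^sup>+x. F x * ennreal (cf_density s x) * indicator {1 / (real j + 1)..1 / real j} x \<partial>lborel)
     = (\<integral>\<^sup>+x. (F x * ennreal (cf_density s x)) * indicator {g 0..g 1} x \<partial>lborel)"
    by (simp add: g_def)
  also have "\<dots> = (\<integral>\<^sup>+u. (F (g u) * ennreal (cf_density s (g u))) * ennreal (g' u) * indicator {0..1} u \<partial>lborel)"
  proof (rule nn_integral_substitution_aux)
    fix u :: real assume u: "u \<in> {0..1}"
    then have p: "real j + 1 - u > 0" using j by auto
    show "(g has_real_derivative g' u) (at u)"
      unfolding g_def g'_def using p
      by (auto intro!: derivative_eq_intros simp: power2_eq_square)
    show "0 \<le> g' u" by (simp add: g'_def)
  next
    show "continuous_on {0..1} g'" unfolding g'_def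
      using j by (intro continuous_intros) auto
  qed auto
  also have "\<dots> = (\<integral>\<^sup>+t. F (1 / (real j + t)) * ennreal (cf_density s (1 / (real j + t))) * ennreal (1 / (real j + t)\<^sup>2) * indicator {0..1} t \<partial>lborel)"
    by (subst nn_integral_real_affine[where c = "-1" and t = 1])
       (auto simp: g_def g'_def intro!: nn_integral_cong split: split_indicator)
  also have "\<dots> = (\<integral>\<^sup>+t. ennreal (cf_prob s j) * (F (1 / (real j + t)) * ennreal (cf_density (1 / (real j + s)) t) * indicator {0..1} t) \<partial>lborel)"
  proof (intro nn_integral_cong)
    fix t :: real
    show "F (1 / (real j + t)) * ennreal (cf_density s (1 / (real j + t))) * ennreal (1 / (real j + t)\<^sup>2) * indicator {0..1} t
      = ennreal (cf_prob s j) * (F (1 / (real j + t)) * ennreal (cf_density (1 / (real j + s)) t) * indicator {0..1} t)"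
    proof (cases "t \<in> {0..1}")
      case True
      then have "ennreal (cf_density s (1 / (real j + t))) * ennreal (1 / (real j + t)\<^sup>2)
          = ennreal (cf_density s (1 / (real j + t)) / (real j + t)\<^sup>2)"
        using s by (subst ennreal_mult'[symmetric]) (auto simp: cf_density_def)
      also have "\<dots> = ennreal (cf_prob s j * cf_density (1 / (real j + s)) t)"
        using True s j by (subst cf_density_branch) auto
      also have "\<dots> = ennreal (cf_prob s j) * ennreal (cf_density (1 / (real j + s)) t)"
        using s by (intro ennreal_mult) (auto simp: cf_prob_def cf_density_def)
      finally have "ennreal (cf_density s (1 / (real j + t))) * ennreal (1 / (real j + t)\<^sup>2)
          = ennreal (cf_prob s j) * ennreal (cf_density (1 / (real j + s)) t)" .
      then show ?thesis using True by (simp add: mult.assoc) (metis mult.left_commute)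
    qed simp
  qed
  also have "\<dots> = ennreal (cf_prob s j) *
       (\<integral>\<^sup>+t. F (1 / (real j + t)) * ennreal (cf_density (1 / (real j + s)) t) * indicator {0..1} t \<partial>lborel)"
    by (rule nn_integral_cmult) measurable
  finally show ?thesis .
qed

text \<open>Conditioning on the first digit \<open>j\<close> turns the law \<open>cf_measure s\<close> of \<open>x\<close> into the law
  \<open>cf_measure (1 / (j + s))\<close> of \<open>gauss_map x\<close>, so the digits are driven by a Markov chain in \<open>s\<close>.\<close>

lemma nn_integral_first_digit_le:
  fixes f :: "nat \<Rightarrow> ennreal"
  assumes s: "0 \<le> s" and G [measurable]: "G \<in> borel_measurable borel"
  shows "(\<integral>\<^sup>+x. f (cf_digit 1 x) * G (gauss_map x) \<partial>cf_measure s)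
     \<le> (\<Sum>i. ennreal (cf_prob s (Suc i)) * f (Suc i) * (\<integral>\<^sup>+x. G x \<partial>cf_measure (1 / (real (Suc i) + s))))"
proof -
  define F where "F x = f (cf_digit 1 x) * G (gauss_map x)" for x
  have [measurable]: "(\<lambda>x. f (cf_digit 1 x)) \<in> borel_measurable borel"
    by (rule measurable_compose[OF cf_digit_measurable]) simp
  have [measurable]: "F \<in> borel_measurable borel" unfolding F_def by measurable
  let ?I = "\<lambda>i. {1 / (real (Suc i) + 1)..1 / real (Suc i)}"
  \<comment> \<open>Neighbouring closed branch intervals share an endpoint, so the indicators sum to
    at least 1; hence an inequality.\<close>
  have cover: "indicator {0<..<1} x \<le> (\<Sum>i. indicator (?I i) x :: ennreal)" for x :: real
  proof (cases "x \<in> {0<..<1}")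
    case True
    define i where "i = nat \<lfloor>1 / x\<rfloor> - 1"
    have "1 / x \<ge> 1" using True by simp
    then have i: "real (Suc i) \<le> 1 / x" "1 / x \<le> real (Suc i) + 1" unfolding i_def by linarith+
    then have "x \<in> ?I i" using True by (auto simp: field_simps)
    then have "1 = (\<Sum>k\<in>{i}. indicator (?I k) x :: ennreal)" by simp
    also have "\<dots> \<le> (\<Sum>i. indicator (?I i) x)" by (intro sum_le_suminf) auto
    finally show ?thesis using True by simp
  qed simp
  have "(\<integral>\<^sup>+x. F x \<partial>cf_measure s)
     = (\<integral>\<^sup>+x. F x * ennreal (cf_density s x) * indicator {0<..<1} x \<partial>lborel)"
    by (rule nn_integral_cf_measure) measurable
  also have "\<dots> \<le> (\<integral>\<^sup>+x. (\<Sum>i. F x * ennreal (cf_density s x) * indicator (?I i) x) \<partial>lborel)"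
    using cover by (intro nn_integral_mono) (simp add: ennreal_suminf_cmult mult_left_mono)
  also have "\<dots> = (\<Sum>i. \<integral>\<^sup>+x. F x * ennreal (cf_density s x) * indicator (?I i) x \<partial>lborel)"
    by (rule nn_integral_suminf) measurable
  also have "\<dots> = (\<Sum>i. ennreal (cf_prob s (Suc i)) * f (Suc i) * (\<integral>\<^sup>+x. G x \<partial>cf_measure (1 / (real (Suc i) + s))))"
  proof (intro suminf_cong)
    fix i
    let ?j = "Suc i" and ?s = "1 / (real (Suc i) + s)"
    have "(\<integral>\<^sup>+t. F (1 / (real ?j + t)) * ennreal (cf_density ?s t) * indicator {0..1} t \<partial>lborel)
      = (\<integral>\<^sup>+t. f ?j * (G t * ennreal (cf_density ?s t) * indicator {0<..<1} t) \<partial>lborel)"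
    \<comment> \<open>At \<open>t = 1\<close> the first digit is \<open>j + 1\<close> instead of
      \<open>j\<close>, so the endpoints are discarded as null points.\<close>
    proof (intro nn_integral_cong_AE, use AE_lborel_neq[of 0] AE_lborel_neq[of 1] in eventually_elim)
      case (elim t)
      show ?case
      proof (cases "t \<in> {0..1}")
        case True
        then show ?thesis using elim gauss_map_branch[of t ?j] by (simp add: F_def mult_ac)
      qed auto
    qed
    also have "\<dots> = f ?j * (\<integral>\<^sup>+t. G t * ennreal (cf_density ?s t) * indicator {0<..<1} t \<partial>lborel)"
      by (rule nn_integral_cmult) measurable
    also have "\<dots> = f ?j * (\<integral>\<^sup>+x. G x \<partial>cf_measure ?s)" by (subst nn_integral_cf_measure) simp_all
    finally show "(\<integral>\<^sup>+x. F x * ennreal (cf_density s x) * indicator (?I i) x \<partial>lborel)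
      = ennreal (cf_prob s ?j) * f ?j * (\<integral>\<^sup>+x. G x \<partial>cf_measure ?s)"
      by (subst nn_integral_branch[OF s]) (simp_all add: mult.assoc)
  qed
  finally show ?thesis by (simp add: F_def)
qed

text \<open>The bound \<open>q k\<close> is required for every \<open>s\<close> in the unit interval
  because the induction peels off the first digit and continues from \<open>1 / (j + s)\<close>,
  which stays in that interval as \<open>j \<ge> 1\<close>. Uniformity in the state thus replaces
  independence.\<close>

lemma nn_integral_prod_digits_le:
  fixes f :: "nat \<Rightarrow> nat \<Rightarrow> ennreal" and q :: "nat \<Rightarrow> ennreal"
  assumes "0 \<le> s" "s \<le> 1"
    and "\<And>k s. k \<in> {1..n} \<Longrightarrow> 0 \<le> s \<Longrightarrow> s \<le> 1 \<Longrightarrow> (\<Sum>i. ennreal (cf_prob s (Suc i)) * f k (Suc i)) \<le> q k"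
  shows "(\<integral>\<^sup>+x. (\<Prod>k=1..n. f k (cf_digit k x)) \<partial>cf_measure s) \<le> (\<Prod>k=1..n. q k)"
  using assms
proof (induction n arbitrary: f q s)
  case 0
  then show ?case using nn_integral_const[of "cf_measure s" 1] by (simp add: emeasure_cf_measure_UNIV)
next
  case (Suc n)
  define G where "G x = (\<Prod>k=1..n. f (Suc k) (cf_digit k x))" for x
  have [measurable]: "(\<lambda>x. f k (cf_digit m x)) \<in> borel_measurable borel" for k m
    by (rule measurable_compose[OF cf_digit_measurable]) simp
  have [measurable]: "G \<in> borel_measurable borel" unfolding G_def by measurable
  have split: "(\<Prod>k=1..Suc n. h k) = h 1 * (\<Prod>k=1..n. h (Suc k))" for h :: "nat \<Rightarrow> ennreal"
    by (subst prod.atLeast_Suc_atMost) (auto simp: prod.shift_bounds_cl_Suc_ivl[symmetric] simp del: prod.cl_ivl_Suc)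
  have "(\<Prod>k=1..Suc n. f k (cf_digit k x)) = f 1 (cf_digit 1 x) * G (gauss_map x)" for x
    unfolding split G_def by (intro arg_cong2[where f = "(*)"] prod.cong) (auto simp: cf_digit_Suc)
  then have "(\<integral>\<^sup>+x. (\<Prod>k=1..Suc n. f k (cf_digit k x)) \<partial>cf_measure s)
      = (\<integral>\<^sup>+x. f 1 (cf_digit 1 x) * G (gauss_map x) \<partial>cf_measure s)" by simp
  also have "\<dots> \<le> (\<Sum>i. ennreal (cf_prob s (Suc i)) * f 1 (Suc i) * (\<integral>\<^sup>+x. G x \<partial>cf_measure (1 / (real (Suc i) + s))))"
    using Suc.prems by (intro nn_integral_first_digit_le) auto
  also have "\<dots> \<le> (\<Sum>i. ennreal (cf_prob s (Suc i)) * f 1 (Suc i) * (\<Prod>k=1..n. q (Suc k)))"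
  proof (intro suminf_le mult_left_mono)
    fix i
    show "(\<integral>\<^sup>+x. G x \<partial>cf_measure (1 / (real (Suc i) + s))) \<le> (\<Prod>k=1..n. q (Suc k))"
      unfolding G_def using Suc.prems by (intro Suc.IH) auto
  qed auto
  also have "\<dots> = (\<Sum>i. ennreal (cf_prob s (Suc i)) * f 1 (Suc i)) * (\<Prod>k=1..n. q (Suc k))"
    by (rule ennreal_suminf_multc)
  also have "\<dots> \<le> q 1 * (\<Prod>k=1..n. q (Suc k))"
    using Suc.prems by (intro mult_right_mono) auto
  also have "\<dots> = (\<Prod>k=1..Suc n. q k)" by (rule split[symmetric])
  finally show ?case .
qed

section \<open>Digit probabilities, uniformly in the state\<close>

lemma cf_prob_upper: "0 \<le> s \<Longrightarrow> s \<le> 1 \<Longrightarrow> j \<ge> 1 \<Longrightarrow> cf_prob s j \<le> 2 / (real j)\<^sup>2"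
  unfolding cf_prob_def power2_eq_square by (intro frac_le mult_mono) auto

lemma cf_prob_lower:
  assumes "0 \<le> s" "s \<le> 1" "j \<ge> 1"
  shows "1 / (6 * (real j)\<^sup>2) \<le> cf_prob s j"
proof -
  have "(real j + s) * (real j + s + 1) \<le> (2 * real j) * (3 * real j)"
    using assms by (intro mult_mono) auto
  then show ?thesis
    unfolding cf_prob_def using assms by (intro frac_le) (auto simp: power2_eq_square)
qed

lemma cf_prob_nonneg: "0 \<le> s \<Longrightarrow> 0 \<le> cf_prob s j"
  unfolding cf_prob_def by simp

lemma cf_prob_sums:
  assumes "0 \<le> s"
  shows "(\<lambda>i. cf_prob s (Suc i)) sums 1"
proof -
  let ?f = "\<lambda>i. (1 + s) / (real (Suc i) + s)"
  have "?f \<longlonglongrightarrow> 0" by real_asymp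
  then have "(\<lambda>i. ?f i - ?f (Suc i)) sums (?f 0 - 0)" by (rule telescope_sums')
  moreover have "?f i - ?f (Suc i) = cf_prob s (Suc i)" for i
    using assms by (simp add: cf_prob_def divide_simps) (simp add: algebra_simps)
  ultimately show ?thesis using assms by simp
qed

text \<open>Splitting off the total mass 1 leaves a finite sum over primes. It is applied with
  \<open>g = -1\<close> on forbidden digits and with \<open>g j = exp (\<sigma> * j) - 1\<close> for
  exponential moments.\<close>

lemma suminf_cf_prob_finite_perturbation:
  fixes g :: "nat \<Rightarrow> real"
  assumes s: "0 \<le> s" and A: "finite A" "0 \<notin> A" and g: "\<And>j. j \<notin> A \<Longrightarrow> g j = 0" "\<And>j. g j \<ge> -1"
  shows "(\<Sum>i. ennreal (cf_prob s (Suc i)) * ennreal (1 + g (Suc i))) = ennreal (1 + (\<Sum>j\<in>A. cf_prob s j * g j))"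
proof -
  have fin: "finite {i. Suc i \<in> A}" using A(1) finite_vimageI[of A Suc] by (simp add: vimage_def)
  have "(\<lambda>i. cf_prob s (Suc i) * g (Suc i)) sums (\<Sum>i | Suc i \<in> A. cf_prob s (Suc i) * g (Suc i))"
    by (rule sums_finite[OF fin]) (use g in auto)
  also have "(\<Sum>i | Suc i \<in> A. cf_prob s (Suc i) * g (Suc i)) = (\<Sum>j\<in>A. cf_prob s j * g j)"
  proof (rule sum.reindex_bij_betw)
    show "bij_betw Suc {i. Suc i \<in> A} A"
      using A(2) by (auto simp: bij_betw_def image_iff) (metis not0_implies_Suc)
  qed
  finally have "(\<lambda>i. cf_prob s (Suc i) + cf_prob s (Suc i) * g (Suc i)) sums (1 + (\<Sum>j\<in>A. cf_prob s j * g j))"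
    by (intro sums_add cf_prob_sums[OF s])
  then have sums: "(\<lambda>i. cf_prob s (Suc i) * (1 + g (Suc i))) sums (1 + (\<Sum>j\<in>A. cf_prob s j * g j))"
    by (simp add: distrib_left)
  have nn: "0 \<le> 1 + g j" for j using g(2)[of j] by linarith
  have "(\<Sum>i. ennreal (cf_prob s (Suc i)) * ennreal (1 + g (Suc i))) = (\<Sum>i. ennreal (cf_prob s (Suc i) * (1 + g (Suc i))))"
    using nn cf_prob_nonneg[OF s] by (simp add: ennreal_mult)
  also have "\<dots> = ennreal (1 + (\<Sum>j\<in>A. cf_prob s j * g j))"
    using nn cf_prob_nonneg[OF s] sums by (intro suminf_ennreal_eq) auto
  finally show ?thesis .
qed

section \<open>Tail estimates for prime digits\<close>

lemma prime_digit_measurable [measurable]: "prime_digit n \<in> measurable borel (count_space UNIV)"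
  unfolding prime_digit_def by measurable

lemma suminf_cf_prob: "0 \<le> s \<Longrightarrow> (\<Sum>i. ennreal (cf_prob s (Suc i))) = 1"
  using suminf_ennreal_eq[OF cf_prob_nonneg cf_prob_sums, of s] by (simp only: ennreal_1)

lemma suminf_cf_prob_gt_le:
  assumes t: "t \<ge> 2" and s: "0 \<le> s" "s \<le> 1"
  shows "(\<Sum>i. ennreal (cf_prob s (Suc i)) * indicator {p. prime p \<and> t < real p} (Suc i)) \<le> ennreal (32 / (t * ln t))"
proof (rule suminf_le_const)
  fix n
  let ?P = "{p. prime p \<and> t < real p}"
  have "(\<Sum>i<n. ennreal (cf_prob s (Suc i)) * indicator ?P (Suc i))
      = (\<Sum>j\<in>{1..n}. ennreal (cf_prob s j) * indicator ?P j)"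
    by (rule sum.reindex_bij_witness[of _ "\<lambda>j. j - 1" Suc]) auto
  also have "\<dots> = (\<Sum>j\<in>{1..n} \<inter> ?P. ennreal (cf_prob s j))"
    by (intro sum.mono_neutral_cong_right) auto
  also have "\<dots> = ennreal (\<Sum>j\<in>{1..n} \<inter> ?P. cf_prob s j)"
    using cf_prob_nonneg[OF s(1)] by (intro sum_ennreal) auto
  also have "\<dots> \<le> ennreal (32 / (t * ln t))"
  proof (rule ennreal_leI)
    have "(\<Sum>j\<in>{1..n} \<inter> ?P. cf_prob s j) \<le> (\<Sum>j\<in>{1..n} \<inter> ?P. 2 * (1 / real j ^ 2))"
      using s cf_prob_upper by (intro sum_mono) auto
    also have "\<dots> \<le> 2 * (16 / (t * ln t))"
      unfolding sum_distrib_left[symmetric]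
      by (intro mult_left_mono sum_inverse_squares_primes_gt_upper[OF t]) auto
    finally show "(\<Sum>j\<in>{1..n} \<inter> ?P. cf_prob s j) \<le> 32 / (t * ln t)" by simp
  qed
  finally show "(\<Sum>i<n. ennreal (cf_prob s (Suc i)) * indicator ?P (Suc i)) \<le> ennreal (32 / (t * ln t))" .
qed simp

text \<open>A marginal law is read off from the product bound by setting all factors but the
  \<open>k\<close>-th to 1.\<close>

lemma emeasure_prime_digit_gt_le:
  assumes t: "t \<ge> 2" and k: "k \<ge> 1"
  shows "emeasure (cf_measure 0) {x. t < real (prime_digit k x)} \<le> ennreal (32 / (t * ln t))"
proof -
  define f :: "nat \<Rightarrow> nat \<Rightarrow> ennreal" where
    "f l = (if l = k then indicator {p. prime p \<and> t < real p} else (\<lambda>_. 1))" for l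
  define q where "q l = (if l = k then ennreal (32 / (t * ln t)) else 1)" for l
  have ind: "indicator {x. t < real (prime_digit k x)} x = (\<Prod>l=1..k. f l (cf_digit l x))" for x
  proof -
    have "(\<Prod>l=1..k. f l (cf_digit l x)) = (\<Prod>l=1..k. if l = k then f l (cf_digit l x) else 1)"
      by (intro prod.cong) (auto simp: f_def)
    also have "\<dots> = f k (cf_digit k x)" using k by (simp add: prod.delta)
    also have "\<dots> = indicator {x. t < real (prime_digit k x)} x"
      using t by (auto simp: f_def prime_digit_def split: split_indicator)
    finally show ?thesis by simp
  qed
  have "emeasure (cf_measure 0) {x. t < real (prime_digit k x)}
      = (\<integral>\<^sup>+x. (\<Prod>l=1..k. f l (cf_digit l x)) \<partial>cf_measure 0)"
    unfolding ind[symmetric] by (subst nn_integral_indicator) simp_all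
  also have "\<dots> \<le> (\<Prod>l=1..k. q l)"
    using suminf_cf_prob_gt_le[OF t] suminf_cf_prob
    by (intro nn_integral_prod_digits_le) (auto simp: f_def q_def)
  also have "\<dots> = ennreal (32 / (t * ln t))" using k by (simp add: q_def prod.delta)
  finally show ?thesis .
qed

text \<open>A quantitative second Borel-Cantelli estimate. Digit \<open>k\<close> has to avoid the
  finite window \<open>A k\<close>, so its factor is 1 minus the probability of that window, at most
  the exponential of minus that probability. The constant is \<open>6144 = 6 * 1024\<close>, from
  \<open>cf_prob_lower\<close> and the prime sum.\<close>

lemma emeasure_prime_digits_le_thresholds:
  fixes t :: "nat \<Rightarrow> real"
  assumes m: "m \<ge> 1" and t: "\<And>k. k \<ge> m \<Longrightarrow> t k \<ge> 8"
  shows "emeasure (cf_measure 0) {x. \<forall>k\<in>{m..n}. real (prime_digit k x) \<le> t k}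
     \<le> ennreal (exp (- (\<Sum>k=m..n. 1 / (6144 * (t k * ln (t k))))))"
proof -
  define A where "A k = {p. prime p \<and> t k < real p \<and> real p \<le> 32 * t k}" for k
  have finA: "finite (A k)" for k
    by (rule finite_subset[of _ "{..nat \<lceil>32 * t k\<rceil>}"]) (auto simp: A_def, linarith)
  define f :: "nat \<Rightarrow> nat \<Rightarrow> ennreal" where
    "f k j = ennreal (1 + (if m \<le> k \<and> j \<in> A k then -1 else 0))" for k j
  define e where "e k = (if m \<le> k then 1 / (6144 * (t k * ln (t k))) else 0)" for k
  have le: "indicator {x. \<forall>k\<in>{m..n}. real (prime_digit k x) \<le> t k} x \<le> (\<Prod>k=1..n. f k (cf_digit k x))" for x
  proof (cases "\<forall>k\<in>{m..n}. real (prime_digit k x) \<le> t k")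
    case True
    have "(\<Prod>k=1..n. f k (cf_digit k x)) = 1"
    proof (intro prod.neutral ballI)
      fix k assume "k \<in> {1..n}"
      then have "\<not> (m \<le> k \<and> cf_digit k x \<in> A k)"
        using True by (auto simp: A_def prime_digit_def dest: bspec[of _ _ k])
      then show "f k (cf_digit k x) = 1" by (auto simp: f_def)
    qed
    then show ?thesis by (simp split: split_indicator)
  qed simp
  have "emeasure (cf_measure 0) {x. \<forall>k\<in>{m..n}. real (prime_digit k x) \<le> t k}
      = (\<integral>\<^sup>+x. indicator {x. \<forall>k\<in>{m..n}. real (prime_digit k x) \<le> t k} x \<partial>cf_measure 0)"
    by (subst nn_integral_indicator) simp_all
  also have "\<dots> \<le> (\<integral>\<^sup>+x. (\<Prod>k=1..n. f k (cf_digit k x)) \<partial>cf_measure 0)"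
    by (intro nn_integral_mono le)
  also have "\<dots> \<le> (\<Prod>k=1..n. ennreal (exp (- e k)))"
  proof (rule nn_integral_prod_digits_le)
    fix k s assume k: "k \<in> {1..n}" and s: "0 \<le> s" "s \<le> (1::real)"
    show "(\<Sum>i. ennreal (cf_prob s (Suc i)) * f k (Suc i)) \<le> ennreal (exp (- e k))"
    proof (cases "m \<le> k")
      case True
      have "(\<Sum>i. ennreal (cf_prob s (Suc i)) * f k (Suc i))
          = ennreal (1 + (\<Sum>j\<in>A k. cf_prob s j * (if m \<le> k \<and> j \<in> A k then -1 else 0)))"
        unfolding f_def using finA
        by (intro suminf_cf_prob_finite_perturbation s) (auto simp: A_def)
      also have "(\<Sum>j\<in>A k. cf_prob s j * (if m \<le> k \<and> j \<in> A k then -1 else 0)) = - (\<Sum>j\<in>A k. cf_prob s j)"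
        using True by (simp add: sum_negf)
      also have "ennreal (1 + - (\<Sum>j\<in>A k. cf_prob s j)) \<le> ennreal (exp (- e k))"
      proof (rule ennreal_leI)
        have "e k = (1 / 6) * (1 / (1024 * (t k * ln (t k))))" using True by (simp add: e_def)
        also have "\<dots> \<le> (1 / 6) * (\<Sum>j\<in>A k. 1 / real j ^ 2)"
          unfolding A_def using t[OF True]
          by (intro mult_left_mono sum_inverse_squares_primes_gt_lower) auto
        also have "\<dots> = (\<Sum>j\<in>A k. 1 / (6 * real j ^ 2))" by (simp add: sum_distrib_left)
        also have "\<dots> \<le> (\<Sum>j\<in>A k. cf_prob s j)"
          using s by (intro sum_mono cf_prob_lower) (auto simp: A_def Suc_le_eq prime_gt_0_nat)
        finally have "1 + - (\<Sum>j\<in>A k. cf_prob s j) \<le> 1 + - e k" by simp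
        also have "\<dots> \<le> exp (- e k)" by (rule exp_ge_add_one_self)
        finally show "1 + - (\<Sum>j\<in>A k. cf_prob s j) \<le> exp (- e k)" .
      qed
      finally show ?thesis .
    next
      case False
      then show ?thesis using suminf_cf_prob[OF s(1)] by (simp add: f_def e_def)
    qed
  qed auto
  also have "\<dots> = ennreal (\<Prod>k=1..n. exp (- e k))" by (rule prod_ennreal) simp
  also have "(\<Prod>k=1..n. exp (- e k)) = exp (- (\<Sum>k=1..n. e k))"
    by (simp add: exp_sum sum_negf[symmetric])
  also have "(\<Sum>k=1..n. e k) = (\<Sum>k=m..n. 1 / (6144 * (t k * ln (t k))))"
    using m by (intro sum.mono_neutral_cong_right) (auto simp: e_def)
  finally show ?thesis .
qed

section \<open>Exponential moments of truncated sums\<close>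

lemma exp_minus_one_le: "0 \<le> x \<Longrightarrow> exp x - 1 \<le> x + x\<^sup>2 * exp (x::real)"
proof -
  assume x: "0 \<le> x"
  have "1 - x \<le> exp (- x)" using exp_ge_add_one_self[of "-x"] by simp
  then have "(1 - x) * exp x \<le> exp (- x) * exp x" by (intro mult_right_mono) auto
  then have a: "exp x - 1 \<le> x * exp x" by (simp add: algebra_simps exp_minus)
  then have "x * (exp x - 1) \<le> x * (x * exp x)" using x by (intro mult_left_mono)
  with a show ?thesis by (simp add: power2_eq_square algebra_simps)
qed

definition truncated_prime_digit :: "real \<Rightarrow> nat \<Rightarrow> real \<Rightarrow> real" where
  "truncated_prime_digit t k x = (if real (prime_digit k x) \<le> t then real (prime_digit k x) else 0)"

lemma truncated_prime_digit_measurable [measurable]: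
  "truncated_prime_digit t k \<in> borel_measurable borel"
  unfolding truncated_prime_digit_def by measurable

text \<open>Markov's inequality for the exponential. The first summand of \<open>q\<close> is the
  mean, a sum of \<open>1 / p\<close>. The second is the quadratic remainder of \<open>exp\<close>,
  in which the square of the digit cancels against its probability, so that only the number of
  primes up to \<open>t\<close> remains.\<close>

lemma emeasure_sum_truncated_gt_le:
  fixes \<sigma> t c :: real
  assumes t: "t \<ge> 2" and \<sigma>: "\<sigma> \<ge> 0"
  defines "q \<equiv> 2 * \<sigma> * (5 + 2 * ln (4 * ln t)) + 2 * \<sigma>\<^sup>2 * exp (\<sigma> * t) * (8 * t / ln t)"
  shows "emeasure (cf_measure 0) {x. c < (\<Sum>k=1..n. truncated_prime_digit t k x)} \<le> ennreal (exp (real n * q - \<sigma> * c))"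
proof -
  define A where "A = {p. prime p \<and> real p \<le> t}"
  have finA: "finite A"
    by (rule finite_subset[of _ "{..nat \<lfloor>t\<rfloor>}"]) (auto simp: A_def le_nat_floor)
  define g where "g j = (if j \<in> A then exp (\<sigma> * real j) - 1 else 0)" for j
  define f :: "nat \<Rightarrow> ennreal" where "f j = ennreal (1 + g j)" for j
  have g0: "g j \<ge> 0" for j unfolding g_def using \<sigma> by auto
  have fY: "ennreal (exp (\<sigma> * truncated_prime_digit t k x)) = f (cf_digit k x)" for k x
    using t by (auto simp: f_def g_def A_def truncated_prime_digit_def prime_digit_def)
  have step: "(\<Sum>i. ennreal (cf_prob s (Suc i)) * f (Suc i)) \<le> ennreal (exp q)" if s: "0 \<le> s" "s \<le> 1" for s
  proof -
    have "(\<Sum>i. ennreal (cf_prob s (Suc i)) * f (Suc i)) = ennreal (1 + (\<Sum>j\<in>A. cf_prob s j * g j))"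
      unfolding f_def
    proof (rule suminf_cf_prob_finite_perturbation[OF s(1) finA])
      show "- 1 \<le> g j" for j using g0[of j] by linarith
    qed (auto simp: A_def g_def)
    also have "\<dots> \<le> ennreal (exp q)"
    proof (rule ennreal_leI)
      have "(\<Sum>j\<in>A. cf_prob s j * g j) \<le> (\<Sum>j\<in>A. 2 * \<sigma> * (1 / real j) + 2 * \<sigma>\<^sup>2 * exp (\<sigma> * t))"
      proof (rule sum_mono)
        fix j assume j: "j \<in> A"
        then have j1: "j \<ge> 1" "real j \<le> t" by (auto simp: A_def Suc_le_eq prime_gt_0_nat)
        have "g j \<le> \<sigma> * real j + (\<sigma> * real j)\<^sup>2 * exp (\<sigma> * real j)"
          unfolding g_def using j \<sigma> by (simp add: exp_minus_one_le)
        also have "\<dots> \<le> \<sigma> * real j + (\<sigma> * real j)\<^sup>2 * exp (\<sigma> * t)"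
          using j1 \<sigma> by (intro add_left_mono mult_left_mono) (auto intro: mult_left_mono)
        finally have gj: "g j \<le> \<sigma> * real j + (\<sigma> * real j)\<^sup>2 * exp (\<sigma> * t)" .
        have "cf_prob s j * g j \<le> (2 / (real j)\<^sup>2) * (\<sigma> * real j + (\<sigma> * real j)\<^sup>2 * exp (\<sigma> * t))"
          using cf_prob_upper[OF s j1(1)] gj g0 by (intro mult_mono) auto
        also have "\<dots> = 2 * \<sigma> * (1 / real j) + 2 * \<sigma>\<^sup>2 * exp (\<sigma> * t)"
          using j1 by (simp add: field_simps power2_eq_square)
        finally show "cf_prob s j * g j \<le> 2 * \<sigma> * (1 / real j) + 2 * \<sigma>\<^sup>2 * exp (\<sigma> * t)" .
      qed
      also have "\<dots> = 2 * \<sigma> * (\<Sum>j\<in>A. 1 / real j) + 2 * \<sigma>\<^sup>2 * exp (\<sigma> * t) * real (card A)"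
        by (simp only: sum.distrib sum_distrib_left sum_constant) (simp add: mult_ac)
      also have "\<dots> \<le> q"
        unfolding q_def A_def using \<sigma>
        by (intro add_mono mult_left_mono sum_inverse_primes_le_upper card_primes_le_upper t) auto
      finally have "1 + (\<Sum>j\<in>A. cf_prob s j * g j) \<le> 1 + q" by simp
      also have "\<dots> \<le> exp q" by (rule exp_ge_add_one_self)
      finally show "1 + (\<Sum>j\<in>A. cf_prob s j * g j) \<le> exp q" .
    qed
    finally show ?thesis .
  qed
  have le: "indicator {x. c < (\<Sum>k=1..n. truncated_prime_digit t k x)} x
      \<le> ennreal (exp (- \<sigma> * c)) * (\<Prod>k=1..n. f (cf_digit k x))" for x
  proof (cases "c < (\<Sum>k=1..n. truncated_prime_digit t k x)")
    case True
    let ?S = "\<Sum>k=1..n. truncated_prime_digit t k x"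
    have "(\<Prod>k=1..n. f (cf_digit k x)) = ennreal (exp (\<sigma> * ?S))"
      unfolding fY[symmetric] by (subst prod_ennreal) (auto simp: exp_sum sum_distrib_left)
    then have "ennreal (exp (- \<sigma> * c)) * (\<Prod>k=1..n. f (cf_digit k x)) = ennreal (exp (\<sigma> * (?S - c)))"
      by (simp add: ennreal_mult'[symmetric] exp_add[symmetric] algebra_simps)
    moreover have "1 \<le> exp (\<sigma> * (?S - c))" using True \<sigma> by simp
    then have "1 \<le> ennreal (exp (\<sigma> * (?S - c)))" by (simp only: ennreal_1[symmetric] ennreal_leI)
    ultimately show ?thesis using True by simp
  qed simp
  have [measurable]: "(\<lambda>x. f (cf_digit k x)) \<in> borel_measurable borel" for k
    by (rule measurable_compose[OF cf_digit_measurable]) simp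
  have "emeasure (cf_measure 0) {x. c < (\<Sum>k=1..n. truncated_prime_digit t k x)}
      = (\<integral>\<^sup>+x. indicator {x. c < (\<Sum>k=1..n. truncated_prime_digit t k x)} x \<partial>cf_measure 0)"
    by (subst nn_integral_indicator) simp_all
  also have "\<dots> \<le> (\<integral>\<^sup>+x. ennreal (exp (- \<sigma> * c)) * (\<Prod>k=1..n. f (cf_digit k x)) \<partial>cf_measure 0)"
    by (intro nn_integral_mono le)
  also have "\<dots> = ennreal (exp (- \<sigma> * c)) * (\<integral>\<^sup>+x. (\<Prod>k=1..n. f (cf_digit k x)) \<partial>cf_measure 0)"
    by (rule nn_integral_cmult) measurable
  also have "\<dots> \<le> ennreal (exp (- \<sigma> * c)) * (\<Prod>k=1..n. ennreal (exp q))"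
    by (intro mult_left_mono nn_integral_prod_digits_le[where f = "\<lambda>_. f"] step) auto
  also have "\<dots> = ennreal (exp (- \<sigma> * c)) * ennreal (exp q ^ n)"
    by (simp add: ennreal_power)
  also have "\<dots> = ennreal (exp (- \<sigma> * c) * exp q ^ n)"
    by (rule ennreal_mult[symmetric]) simp_all
  also have "exp (- \<sigma> * c) * exp q ^ n = exp (real n * q - \<sigma> * c)"
    by (simp add: exp_of_nat_mult[symmetric] exp_add[symmetric])
  finally show ?thesis .
qed

lemma emeasure_sum_prime_digits_gt_le:
  fixes \<sigma> t c :: real
  assumes t: "t \<ge> 2" and \<sigma>: "\<sigma> \<ge> 0"
  defines "q \<equiv> 2 * \<sigma> * (5 + 2 * ln (4 * ln t)) + 2 * \<sigma>\<^sup>2 * exp (\<sigma> * t) * (8 * t / ln t)"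
  shows "emeasure (cf_measure 0) {x. c < (\<Sum>k=1..n. real (prime_digit k x))}
    \<le> ennreal (real n * (32 / (t * ln t)) + exp (real n * q - \<sigma> * c))"
proof -
  let ?E = "\<lambda>k. {x. t < real (prime_digit k x)}" and ?F = "{x. c < (\<Sum>k=1..n. truncated_prime_digit t k x)}"
  have "{x. c < (\<Sum>k=1..n. real (prime_digit k x))} \<subseteq> (\<Union>k\<in>{1..n}. ?E k) \<union> ?F"
  proof
    fix x assume x: "x \<in> {x. c < (\<Sum>k=1..n. real (prime_digit k x))}"
    show "x \<in> (\<Union>k\<in>{1..n}. ?E k) \<union> ?F"
    proof (cases "\<exists>k\<in>{1..n}. t < real (prime_digit k x)")
      case False
      then have "(\<Sum>k=1..n. truncated_prime_digit t k x) = (\<Sum>k=1..n. real (prime_digit k x))"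
        by (intro sum.cong) (auto simp: truncated_prime_digit_def not_less)
      then show ?thesis using x by simp
    qed auto
  qed
  then have "emeasure (cf_measure 0) {x. c < (\<Sum>k=1..n. real (prime_digit k x))}
      \<le> emeasure (cf_measure 0) ((\<Union>k\<in>{1..n}. ?E k) \<union> ?F)"
    by (intro emeasure_mono) auto
  also have "\<dots> \<le> emeasure (cf_measure 0) (\<Union>k\<in>{1..n}. ?E k) + emeasure (cf_measure 0) ?F"
    by (intro emeasure_subadditive) auto
  also have "\<dots> \<le> (\<Sum>k\<in>{1..n}. emeasure (cf_measure 0) (?E k)) + emeasure (cf_measure 0) ?F"
    by (intro add_right_mono emeasure_subadditive_finite) auto
  also have "\<dots> \<le> (\<Sum>k\<in>{1..n}. ennreal (32 / (t * ln t))) + ennreal (exp (real n * q - \<sigma> * c))"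
    unfolding q_def using t \<sigma>
    by (intro add_mono sum_mono emeasure_prime_digit_gt_le emeasure_sum_truncated_gt_le) auto
  also have "(\<Sum>k\<in>{1..n}. ennreal (32 / (t * ln t))) = ennreal (real n * (32 / (t * ln t)))"
    using t by (subst sum_ennreal) auto
  also have "ennreal (real n * (32 / (t * ln t))) + ennreal (exp (real n * q - \<sigma> * c))
      = ennreal (real n * (32 / (t * ln t)) + exp (real n * q - \<sigma> * c))"
    using t by (intro ennreal_plus[symmetric]) auto
  finally show ?thesis .
qed

section \<open>The dichotomy\<close>

lemma AE_cf_measure_0D:
  assumes "AE x in cf_measure 0. P x"
  shows "AE x in lborel. x \<in> {0<..1} \<longrightarrow> P x"
proof -
  have "AE x in lborel. 0 < ennreal (cf_density 0 x) * indicator {0<..<1} x \<longrightarrow> P x"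
    using assms unfolding cf_measure_def by (subst (asm) AE_density) auto
  then show ?thesis
    using AE_lborel_neq[of 1] by eventually_elim (auto simp: cf_density_def indicator_def)
qed

lemma ln_diff_le_sum_inverse:
  assumes "1 \<le> l" "l \<le> Suc j"
  shows "ln (real (Suc j)) - ln (real l) \<le> (\<Sum>i=l..j. 1 / real i)"
  using assms(2)
proof (induction j)
  case 0
  then show ?case using assms(1) by (cases "l = 1") auto
next
  case (Suc j)
  show ?case
  proof (cases "l = Suc (Suc j)")
    case False
    then have l: "l \<le> Suc j" using Suc.prems by simp
    have "ln (real (Suc (Suc j)) / real (Suc j)) \<le> real (Suc (Suc j)) / real (Suc j) - 1"
      by (intro ln_le_minus_one) auto
    also have "\<dots> = 1 / real (Suc j)" by (simp add: field_simps)
    finally have "ln (real (Suc (Suc j))) - ln (real (Suc j)) \<le> 1 / real (Suc j)"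
      by (simp add: ln_div)
    with Suc.IH[OF l] l show ?thesis by simp
  qed simp
qed

text \<open>On the range \<open>max M (ln (g j)) \<le> i \<le> j\<close> the \<open>i\<close>-th term of the series is at least
  \<open>1 / (2 i g j)\<close>, so a small tail forces \<open>ln j\<close> to be small against \<open>g j\<close>.\<close>

lemma ln_index_over_growth_tendsto_0:
  fixes g :: "nat \<Rightarrow> real"
  assumes mono: "\<And>i j. i \<le> j \<Longrightarrow> g i \<le> g j"
    and lim: "filterlim g at_top sequentially"
    and summ: "summable (\<lambda>i. 1 / (g i * (real i * ln 2 + ln (g i))))"
  shows "(\<lambda>j. ln (real j) / g j) \<longlonglongrightarrow> 0"
proof (rule tendstoI)
  let ?c = "\<lambda>i. 1 / (g i * (real i * ln 2 + ln (g i)))"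
  fix \<epsilon> :: real assume \<epsilon>: "\<epsilon> > 0"
  \<comment> \<open>The tail is multiplied by \<open>2 * g j\<close> below, so
    \<open>\<epsilon> / 4\<close> becomes the share \<open>\<epsilon> / 2\<close> of
    \<open>g j\<close>.\<close>
  obtain M0 where M0: "\<And>m n. m \<ge> M0 \<Longrightarrow> norm (sum ?c {m..<n}) < \<epsilon> / 4"
    using summ \<epsilon> unfolding summable_Cauchy by (metis zero_less_divide_iff zero_less_numeral)
  obtain M1 where M1: "\<And>i. i \<ge> M1 \<Longrightarrow> g i \<ge> 1"
    using lim unfolding filterlim_at_top eventually_sequentially by metis
  define M where "M = max 1 (max M0 M1)"
  have main: "ln (real j) / g j \<le> ln (real M + 1 + ln (g j)) / g j + \<epsilon> / 2" if j: "j \<ge> M" for j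
  proof -
    have gj: "g j \<ge> 1" using M1[of j] j by (simp add: M_def)
    \<comment> \<open>Starting at \<open>l\<close> ensures
      \<open>ln (g i) \<le> ln (g j) \<le> i\<close>. The skipped part costs only
      \<open>ln l\<close>, about \<open>ln (ln (g j))\<close>, which is negligible against
      \<open>g j\<close>.\<close>
    define l where "l = max M (nat \<lceil>ln (g j)\<rceil>)"
    have l1: "l \<ge> 1" "l \<ge> M" "ln (g j) \<le> real l" unfolding l_def M_def by linarith+
    have lgj: "ln (g j) \<ge> 0" using gj by simp
    have l2: "real l \<le> real M + 1 + ln (g j)" unfolding l_def using lgj by linarith
    have lnl: "ln (real l) \<le> ln (real M + 1 + ln (g j))" using l1 l2 by (subst ln_le_cancel_iff) auto
    have "ln (real j) - ln (real l) \<le> g j * (\<epsilon> / 2)"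
    proof (cases "l \<le> j")
      case False
      then have "ln (real j) \<le> ln (real l)" using j M_def by (subst ln_le_cancel_iff) auto
      moreover have "0 \<le> g j * (\<epsilon> / 2)" using gj \<epsilon> by simp
      ultimately show ?thesis by linarith
    next
      case True
      have "ln (real j) \<le> ln (real (Suc j))" using j by (subst ln_le_cancel_iff) (auto simp: M_def)
      then have "ln (real j) - ln (real l) \<le> (\<Sum>i=l..j. 1 / real i)"
        using ln_diff_le_sum_inverse[OF l1(1) le_SucI[OF True]] by linarith
      also have "\<dots> \<le> (\<Sum>i=l..j. 2 * g j * ?c i)"
      proof (rule sum_mono)
        fix i assume i: "i \<in> {l..j}"
        have gi: "1 \<le> g i" "g i \<le> g j" using M1[of i] mono[of i j] i l1 by (auto simp: M_def)
        have lgi: "0 \<le> ln (g i)" using gi by simp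
        have "ln (g i) \<le> ln (g j)" using gi by (subst ln_le_cancel_iff) auto
        then have "ln (g i) \<le> real i" using l1(3) i by auto
        moreover have "real i * ln 2 \<le> real i * 1" using ln_2_less_1 by (intro mult_left_mono) auto
        ultimately have up: "real i * ln 2 + ln (g i) \<le> 2 * real i" by simp
        have i1: "real i \<ge> 1" using i l1 by auto
        have pos: "0 < real i * ln 2 + ln (g i)" using lgi i1 by (intro add_pos_nonneg) auto
        have "g i * (real i * ln 2 + ln (g i)) \<le> g j * (2 * real i)"
          using gi up pos by (intro mult_mono) auto
        then have "1 / (g j * (2 * real i)) \<le> ?c i"
          using gi pos i1 by (intro divide_left_mono mult_pos_pos) auto
        then have "2 * g j * (1 / (g j * (2 * real i))) \<le> 2 * g j * ?c i"
          using gj by (intro mult_left_mono) auto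
        then show "1 / real i \<le> 2 * g j * ?c i" using gj by simp
      qed
      also have "\<dots> = 2 * g j * sum ?c {l..<Suc j}"
        by (simp only: sum_distrib_left atLeastLessThanSuc_atLeastAtMost)
      also have "\<dots> \<le> 2 * g j * (\<epsilon> / 4)"
      proof (intro mult_left_mono)
        show "sum ?c {l..<Suc j} \<le> \<epsilon> / 4" using M0[of l "Suc j"] l1 by (simp add: M_def)
      qed (use gj in simp)
      also have "\<dots> = g j * (\<epsilon> / 2)" by simp
      finally show ?thesis .
    qed
    then have "ln (real j) \<le> ln (real M + 1 + ln (g j)) + g j * (\<epsilon> / 2)" using lnl by linarith
    then have "ln (real j) / g j \<le> (ln (real M + 1 + ln (g j)) + g j * (\<epsilon> / 2)) / g j"
      using gj by (intro divide_right_mono) auto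
    then show ?thesis using gj by (simp add: add_divide_distrib)
  qed
  have "((\<lambda>y. ln (real M + 1 + ln y) / y) \<longlongrightarrow> 0) at_top" by real_asymp
  then have "((\<lambda>j. ln (real M + 1 + ln (g j)) / g j) \<longlongrightarrow> 0) sequentially"
    using lim by (rule filterlim_compose)
  then have "\<forall>\<^sub>F j in sequentially. ln (real M + 1 + ln (g j)) / g j < \<epsilon> / 2"
    using \<epsilon> by (intro order_tendstoD(2)) auto
  then show "\<forall>\<^sub>F j in sequentially. dist (ln (real j) / g j) 0 < \<epsilon>"
    using eventually_ge_at_top[of M]
  proof eventually_elim
    case (elim j)
    have "g j \<ge> 1" "j \<ge> 1" using M1[of j] elim by (auto simp: M_def)
    then have "0 \<le> ln (real j) / g j" by simp
    then have "dist (ln (real j) / g j) 0 = ln (real j) / g j" by (simp only: dist_real_def diff_zero abs_of_nonneg)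
    moreover have "ln (real j) / g j < \<epsilon>" using main[of j] elim by linarith
    ultimately show ?case by simp
  qed
qed

section \<open>Norming sequences along powers of two\<close>

locale superlinear_norming =
  fixes b :: "nat \<Rightarrow> real"
  assumes b_gt1: "\<And>n. n \<ge> 1 \<Longrightarrow> b n > 1"
    and b_mono: "\<And>m n. 1 \<le> m \<Longrightarrow> m \<le> n \<Longrightarrow> b m / real m \<le> b n / real n"
    and b_lim: "filterlim (\<lambda>n. b n / real n) at_top sequentially"
begin

lemma b_increasing: "1 \<le> m \<Longrightarrow> m \<le> n \<Longrightarrow> b m \<le> b n"
proof -
  assume mn: "1 \<le> m" "m \<le> n"
  have "b m = real m * (b m / real m)" using mn by simp
  also have "\<dots> \<le> real n * (b n / real n)"
    using mn b_mono[of m n] b_gt1[of m] by (intro mult_mono) auto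
  also have "\<dots> = b n" using mn by simp
  finally show ?thesis .
qed

lemma b_at_top: "filterlim b at_top sequentially"
proof (rule filterlim_at_top_mono[OF b_lim])
  have "b n / real n \<le> b n / 1" if "n \<ge> 1" for n
    using b_gt1[OF that] that by (intro divide_left_mono) auto
  then show "\<forall>\<^sub>F n in sequentially. b n / real n \<le> b n"
    by (intro eventually_sequentiallyI[of 1]) simp
qed

definition growth :: "nat \<Rightarrow> real" where
  "growth i = b (2 ^ i) / 2 ^ i"

lemma growth_mono: "i \<le> j \<Longrightarrow> growth i \<le> growth j"
  using b_mono[of "2 ^ i" "2 ^ j"] by (simp add: growth_def)

lemma growth_pos: "growth i > 0"
  using b_gt1[of "2 ^ i"] by (simp add: growth_def)

lemma filterlim_power2_nat: "filterlim (\<lambda>i. 2 ^ i :: nat) at_top sequentially"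
  by (rule filterlim_subseq) (auto simp: strict_mono_def)

lemma growth_at_top: "filterlim growth at_top sequentially"
  using filterlim_compose[OF b_lim filterlim_power2_nat] by (simp add: growth_def[abs_def])

lemma b_power2: "b (2 ^ i) = growth i * 2 ^ i"
  by (simp add: growth_def)

lemma ln_b_power2: "ln (b (2 ^ i)) = real i * ln 2 + ln (growth i)"
  using growth_pos[of i] by (simp add: b_power2 ln_mult ln_realpow)

text \<open>Cauchy condensation. Up to a constant, the \<open>i\<close>-th term is the union bound
  for a digit up to index \<open>2 ^ (i + 1)\<close> exceeding a fixed multiple of
  \<open>b (2 ^ i)\<close>.\<close>

lemma summable_condensed:
  assumes "summable (\<lambda>n. 1 / (b (Suc n) * ln (b (Suc n))))"
  shows "summable (\<lambda>i. 2 ^ i / (b (2 ^ i) * ln (b (2 ^ i))))"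
proof -
  \<comment> \<open>\<open>b 0\<close> is unconstrained, hence the default value 0.\<close>
  define f where "f n = (if n = 0 then 0 else 1 / (b n * ln (b n)))" for n
  have "summable (\<lambda>n. f (Suc n))" using assms by (simp add: f_def)
  then have "summable f" by (rule summable_Suc_iff[THEN iffD1])
  moreover have "f (Suc m) \<le> f m" if "0 < m" for m
  proof -
    have "1 < b m" "b m \<le> b (Suc m)" using b_gt1[of m] b_increasing[of m "Suc m"] that by auto
    then have "b m * ln (b m) \<le> b (Suc m) * ln (b (Suc m))" "0 < b m * ln (b m)"
      by (auto intro!: mult_mono)
    then have "1 / (b (Suc m) * ln (b (Suc m))) \<le> 1 / (b m * ln (b m))" by (intro frac_le) auto
    then show ?thesis using that by (simp add: f_def)
  qed
  moreover have "f n \<ge> 0" for n using b_gt1[of n] by (auto simp: f_def)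
  ultimately have "summable (\<lambda>i. 2 ^ i * f (2 ^ i))" by (subst (asm) condensation_test) auto
  then show ?thesis by (simp add: f_def)
qed

text \<open>This controls the mean: \<open>ln (b (2 ^ j))\<close> is
  \<open>j * ln 2 + ln (growth j)\<close>, so its logarithm is governed by \<open>ln j\<close> and
  \<open>ln (growth j)\<close>, and the latter is negligible against \<open>growth j\<close>
  anyway.\<close>

lemma ln_index_over_growth:
  assumes "summable (\<lambda>n. 1 / (b (Suc n) * ln (b (Suc n))))"
  shows "(\<lambda>j. ln (real j) / growth j) \<longlonglongrightarrow> 0"
proof (rule ln_index_over_growth_tendsto_0[OF growth_mono growth_at_top])
  have "(\<lambda>i. 2 ^ i / (b (2 ^ i) * ln (b (2 ^ i)))) = (\<lambda>i. 1 / (growth i * (real i * ln 2 + ln (growth i))))"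
    by (intro ext, simp only: ln_b_power2, simp only: b_power2) simp
  then show "summable (\<lambda>i. 1 / (growth i * (real i * ln 2 + ln (growth i))))"
    using summable_condensed[OF assms] by simp
qed

text \<open>With truncation at \<open>t = \<delta> * b (2 ^ j)\<close>, the conditions on
  \<open>\<delta>\<close> make \<open>t \<ge> 2\<close> and
  \<open>b (2 ^ j) \<le> t\<^sup>2\<close>. The last two bound the mean and the quadratic remainder
  in the exponential moment.\<close>

lemma eventually_block_parameters:
  assumes summ: "summable (\<lambda>n. 1 / (b (Suc n) * ln (b (Suc n))))" and \<epsilon>: "\<epsilon> > 0" and \<delta>: "\<delta> > 0"
  shows "\<forall>\<^sub>F j in sequentially. 1 \<le> j \<and> 1 \<le> growth j \<and> 2 \<le> \<delta> * b (2 ^ j) \<and> 1 \<le> \<delta>\<^sup>2 * b (2 ^ j)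
     \<and> (4 / growth j) * (5 + 2 * (ln 4 + ln (real j) + ln (growth j))) \<le> \<epsilon> / 2
     \<and> 128 * \<delta> * (4 / \<epsilon> * ln (real j))\<^sup>2 / sqrt (real j) \<le> 1"
proof -
  have B: "filterlim (\<lambda>j. b (2 ^ j)) at_top sequentially"
    by (rule filterlim_compose[OF b_at_top filterlim_power2_nat])
  have 1: "\<forall>\<^sub>F j in sequentially. 2 / \<delta> \<le> b (2 ^ j)" "\<forall>\<^sub>F j in sequentially. 1 / \<delta>\<^sup>2 \<le> b (2 ^ j)"
    "\<forall>\<^sub>F j in sequentially. 1 \<le> growth j"
    using B growth_at_top unfolding filterlim_at_top by auto
  have "((\<lambda>y::real. (4 / y) * (5 + 2 * ln 4) + 8 * (ln y / y)) \<longlongrightarrow> 0) at_top" by real_asymp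
  then have "(\<lambda>j. (4 / growth j) * (5 + 2 * ln 4) + 8 * (ln (growth j) / growth j)) \<longlonglongrightarrow> 0"
    using growth_at_top by (rule filterlim_compose)
  then have "(\<lambda>j. ((4 / growth j) * (5 + 2 * ln 4) + 8 * (ln (growth j) / growth j)) + 8 * (ln (real j) / growth j)) \<longlonglongrightarrow> 0 + 8 * 0"
    by (intro tendsto_add tendsto_mult ln_index_over_growth[OF summ] tendsto_const)
  also have "(\<lambda>j. ((4 / growth j) * (5 + 2 * ln 4) + 8 * (ln (growth j) / growth j)) + 8 * (ln (real j) / growth j))
     = (\<lambda>j. (4 / growth j) * (5 + 2 * (ln 4 + ln (real j) + ln (growth j))))"
    by (intro ext) (simp add: add_divide_distrib algebra_simps)
  finally have "(\<lambda>j. (4 / growth j) * (5 + 2 * (ln 4 + ln (real j) + ln (growth j)))) \<longlonglongrightarrow> 0" by simp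
  then have 2: "\<forall>\<^sub>F j in sequentially. (4 / growth j) * (5 + 2 * (ln 4 + ln (real j) + ln (growth j))) < \<epsilon> / 2"
    using \<epsilon> by (intro order_tendstoD(2)) auto
  have "(\<lambda>j::nat. 128 * \<delta> * (4 / \<epsilon> * ln (real j))\<^sup>2 / sqrt (real j)) \<longlonglongrightarrow> 0"
    using \<epsilon> \<delta> by real_asymp
  then have 3: "\<forall>\<^sub>F j in sequentially. 128 * \<delta> * (4 / \<epsilon> * ln (real j))\<^sup>2 / sqrt (real j) < 1"
    by (intro order_tendstoD(2)) auto
  show ?thesis
    using 1 2 3 eventually_ge_at_top[of 1]
    by eventually_elim (use \<delta> in \<open>auto simp: field_simps\<close>)
qed

text \<open>The digits up to \<open>2 ^ (j + 1)\<close> are truncated at \<open>\<delta> * b (2 ^ j)\<close> with \<open>\<delta> = \<epsilon> / 8\<close>, and the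
  exponential moment is taken at \<open>K / b (2 ^ j)\<close> with \<open>K = 4 / \<epsilon> * ln j\<close>: then \<open>exp (K * \<delta>)\<close> is only
  \<open>sqrt j\<close>, while \<open>exp (- K * \<epsilon>)\<close> is small enough to be summable.\<close>

lemma eventually_block_bound:
  assumes summ: "summable (\<lambda>n. 1 / (b (Suc n) * ln (b (Suc n))))" and \<epsilon>: "0 < \<epsilon>" "\<epsilon> \<le> 1"
  shows "\<forall>\<^sub>F j in sequentially.
    emeasure (cf_measure 0) {x. \<epsilon> * b (2 ^ j) < (\<Sum>k=1..2 ^ (j + 1). real (prime_digit k x))}
      \<le> ennreal (1024 / \<epsilon> * (2 ^ j / (b (2 ^ j) * ln (b (2 ^ j)))) + exp 1 * inverse (real j ^ 2))"
proof -
  define \<delta> where "\<delta> = \<epsilon> / 8"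
  have \<delta>: "0 < \<delta>" "\<delta> \<le> 1" using \<epsilon> by (auto simp: \<delta>_def)
  show ?thesis
    using eventually_block_parameters[OF summ \<epsilon>(1) \<delta>(1)]
  proof eventually_elim
    case (elim j)
    define B where "B = b (2 ^ j)"
    define G where "G = growth j"
    define K where "K = 4 / \<epsilon> * ln (real j)"
    define t where "t = \<delta> * B"
    define \<sigma> where "\<sigma> = K / B"
    define q where "q = 2 * \<sigma> * (5 + 2 * ln (4 * ln t)) + 2 * \<sigma>\<^sup>2 * exp (\<sigma> * t) * (8 * t / ln t)"
    have j: "1 \<le> j" and G1: "1 \<le> G" and t2: "2 \<le> t" and tB: "1 \<le> \<delta>\<^sup>2 * B"
      and L: "(4 / G) * (5 + 2 * (ln 4 + ln (real j) + ln G)) \<le> \<epsilon> / 2"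
      and Q: "128 * \<delta> * K\<^sup>2 / sqrt (real j) \<le> 1"
      using elim by (simp_all add: B_def G_def K_def t_def)
    have BG: "B = G * 2 ^ j" by (simp add: B_def G_def b_power2)
    have B1: "B > 1" unfolding B_def by (intro b_gt1) simp
    have K0: "K \<ge> 0" using j \<epsilon> by (simp add: K_def)
    have \<sigma>0: "\<sigma> \<ge> 0" using K0 B1 by (simp add: \<sigma>_def)
    have lnB: "ln B = real j * ln 2 + ln G" by (simp add: B_def G_def ln_b_power2)
    have lnG: "0 \<le> ln G" using G1 by simp
    have "real j * (1 / 2) \<le> real j * ln 2" using ln2_ge_two_thirds by (intro mult_left_mono) auto
    then have lnBj: "real j / 2 \<le> ln B" using lnB lnG by simp
    \<comment> \<open>Lowering the threshold from \<open>B\<close> to \<open>t\<close> costs only a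
      factor 2 in the logarithm.\<close>
    have "B \<le> (\<delta>\<^sup>2 * B) * B" using tB B1 by simp
    also have "\<dots> = t\<^sup>2" by (simp add: t_def power2_eq_square)
    finally have "ln B \<le> ln (t\<^sup>2)" using B1 t2 by (subst ln_le_cancel_iff) auto
    also have "\<dots> = 2 * ln t" using t2 by (simp add: ln_realpow)
    finally have lnt: "ln B / 2 \<le> ln t" by simp
    have lntj: "real j / 4 \<le> ln t" using lnt lnBj by simp
    have lnt0: "0 < ln t" using t2 by simp
    have "ln t \<le> ln B" using \<delta> B1 t2 unfolding t_def by (subst ln_le_cancel_iff) auto
    also have "\<dots> \<le> real j * 1 + (G - 1)"
      unfolding lnB using ln_2_less_1 G1 by (intro add_mono mult_left_mono ln_le_minus_one) auto
    also have "\<dots> \<le> real j * G"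
    proof -
      have "0 \<le> (real j - 1) * (G - 1)" using j G1 by simp
      then show ?thesis by (simp add: algebra_simps)
    qed
    finally have "ln (4 * ln t) \<le> ln (4 * (real j * G))"
      using lnt0 j G1 by (subst ln_le_cancel_iff) auto
    also have "\<dots> = ln 4 + ln (real j) + ln G" using j G1 by (simp add: ln_mult)
    finally have L': "5 + 2 * ln (4 * ln t) \<le> 5 + 2 * (ln 4 + ln (real j) + ln G)" by simp
    have "\<sigma> * t = ln (real j) / 2" using B1 \<epsilon> by (simp add: \<sigma>_def t_def K_def \<delta>_def)
    then have exps: "exp (\<sigma> * t) = sqrt (real j)"
      using j by (simp add: powr_half_sqrt[symmetric] powr_def)
    \<comment> \<open>The mean part: \<open>2 ^ (j + 1) * 2 * \<sigma>\<close> is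
      \<open>4 * K / G\<close>, and \<open>L\<close> bounds the product by
      \<open>K * \<epsilon> / 2\<close>.\<close>
    have p1: "real (2 ^ (j + 1)) * (2 * \<sigma> * (5 + 2 * ln (4 * ln t))) \<le> 2 * ln (real j)"
    proof -
      have "real (2 ^ (j + 1)) * (2 * \<sigma> * (5 + 2 * ln (4 * ln t))) = K * ((4 / G) * (5 + 2 * ln (4 * ln t)))"
        using G1 by (simp add: \<sigma>_def BG)
      also have "\<dots> \<le> K * (\<epsilon> / 2)"
      proof (intro mult_left_mono[OF _ K0])
        have "(4 / G) * (5 + 2 * ln (4 * ln t)) \<le> (4 / G) * (5 + 2 * (ln 4 + ln (real j) + ln G))"
          using G1 L' by (intro mult_left_mono) auto
        then show "(4 / G) * (5 + 2 * ln (4 * ln t)) \<le> \<epsilon> / 2" using L by linarith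
      qed
      also have "\<dots> = 2 * ln (real j)" using \<epsilon> by (simp add: K_def)
      finally show ?thesis .
    qed
    \<comment> \<open>The quadratic part: the factor \<open>sqrt j\<close> from the exponential is
      beaten by \<open>ln t \<ge> j / 4\<close>.\<close>
    have p2: "real (2 ^ (j + 1)) * (2 * \<sigma>\<^sup>2 * exp (\<sigma> * t) * (8 * t / ln t)) \<le> 1"
    proof -
      have "real (2 ^ (j + 1)) * (2 * \<sigma>\<^sup>2 * exp (\<sigma> * t) * (8 * t / ln t))
          = 32 * \<delta> * K\<^sup>2 * sqrt (real j) * (1 / (G * ln t))"
        unfolding exps using G1 by (simp add: \<sigma>_def t_def BG power2_eq_square field_simps)
      also have "\<dots> \<le> 32 * \<delta> * K\<^sup>2 * sqrt (real j) * (1 / (1 * (real j / 4)))"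
        using G1 lntj j lnt0 \<delta> by (intro mult_left_mono divide_left_mono mult_mono mult_pos_pos) auto
      also have "\<dots> = 128 * \<delta> * K\<^sup>2 * (sqrt (real j) / real j)" by simp
      also have "\<dots> = 128 * \<delta> * K\<^sup>2 / sqrt (real j)" using j by (simp add: sqrt_divide_self_eq inverse_eq_divide)
      also have "\<dots> \<le> 1" by (rule Q)
      finally show ?thesis .
    qed
    \<comment> \<open>The level contributes \<open>4 * ln j\<close> and the mean uses up at most
      half of it, which leaves the summable \<open>1 / j\<^sup>2\<close>.\<close>
    have "\<sigma> * (\<epsilon> * B) = 4 * ln (real j)" using B1 \<epsilon> by (simp add: \<sigma>_def K_def)
    then have "real (2 ^ (j + 1)) * q - \<sigma> * (\<epsilon> * B) \<le> 1 - 2 * ln (real j)"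
      using p1 p2 unfolding q_def distrib_left by linarith
    then have "exp (real (2 ^ (j + 1)) * q - \<sigma> * (\<epsilon> * B)) \<le> exp (1 - 2 * ln (real j))" by simp
    also have "\<dots> = exp 1 * inverse (real j ^ 2)"
      using j by (simp add: exp_diff exp_double inverse_eq_divide)
    finally have e: "exp (real (2 ^ (j + 1)) * q - \<sigma> * (\<epsilon> * B)) \<le> exp 1 * inverse (real j ^ 2)" .
    have "32 / (t * ln t) \<le> 32 / (\<delta> * B * (ln B / 2))"
      using lnt \<delta> B1 t2 lnt0 unfolding t_def[symmetric]
      by (intro divide_left_mono mult_left_mono mult_pos_pos) auto
    then have "real (2 ^ (j + 1)) * (32 / (t * ln t)) \<le> real (2 ^ (j + 1)) * (32 / (\<delta> * B * (ln B / 2)))"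
      by (intro mult_left_mono) auto
    \<comment> \<open>\<open>1024 = 2 * 32 * 8 * 2\<close>: block length, tail constant,
      \<open>\<delta> = \<epsilon> / 8\<close> and the halved logarithm.\<close>
    also have "\<dots> = 1024 / \<epsilon> * (2 ^ j / (B * ln B))" by (simp add: \<delta>_def field_simps)
    finally have f: "real (2 ^ (j + 1)) * (32 / (t * ln t)) \<le> 1024 / \<epsilon> * (2 ^ j / (B * ln B))" .
    have "emeasure (cf_measure 0) {x. \<epsilon> * B < (\<Sum>k=1..2 ^ (j + 1). real (prime_digit k x))}
        \<le> ennreal (real (2 ^ (j + 1)) * (32 / (t * ln t)) + exp (real (2 ^ (j + 1)) * q - \<sigma> * (\<epsilon> * B)))"
      unfolding q_def by (rule emeasure_sum_prime_digits_gt_le[OF t2 \<sigma>0])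
    also have "\<dots> \<le> ennreal (1024 / \<epsilon> * (2 ^ j / (B * ln B)) + exp 1 * inverse (real j ^ 2))"
      by (intro ennreal_leI add_mono e f)
    finally show ?case unfolding B_def .
  qed
qed

lemma AE_eventually_block_le:
  assumes summ: "summable (\<lambda>n. 1 / (b (Suc n) * ln (b (Suc n))))" and \<epsilon>: "0 < \<epsilon>" "\<epsilon> \<le> 1"
  shows "AE x in cf_measure 0. \<forall>\<^sub>F j in sequentially. (\<Sum>k=1..2 ^ (j + 1). real (prime_digit k x)) \<le> \<epsilon> * b (2 ^ j)"
proof -
  let ?A = "\<lambda>j. {x. \<epsilon> * b (2 ^ j) < (\<Sum>k=1..2 ^ (j + 1). real (prime_digit k x))}"
  let ?u = "\<lambda>j. 1024 / \<epsilon> * (2 ^ j / (b (2 ^ j) * ln (b (2 ^ j)))) + exp 1 * inverse (real j ^ 2)"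
  have "AE x in cf_measure 0. \<forall>\<^sub>F j in sequentially. x \<in> space (cf_measure 0) - ?A j"
  proof (rule borel_cantelli_AE1)
    show "?A j \<in> sets (cf_measure 0)" for j by measurable
    have "emeasure (cf_measure 0) (?A j) \<le> emeasure (cf_measure 0) UNIV" for j by (intro emeasure_mono) auto
    then show "emeasure (cf_measure 0) (?A j) < \<infinity>" for j
      by (rule order.strict_trans1) (simp add: emeasure_cf_measure_UNIV)
    have u0: "0 \<le> ?u j" for j using b_gt1[of "2 ^ j"] \<epsilon> by simp
    have "summable ?u"
      by (intro summable_add summable_mult summable_condensed[OF summ] inverse_power_summable) simp
    moreover have "\<forall>\<^sub>F j in sequentially. norm (measure (cf_measure 0) (?A j)) \<le> ?u j"
      using eventually_block_bound[OF summ \<epsilon>]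
    proof eventually_elim
      case (elim j)
      then show ?case using u0[of j] unfolding measure_def real_norm_def abs_of_nonneg[OF enn2real_nonneg]
        by (rule enn2real_leI[rotated])
    qed
    ultimately show "summable (\<lambda>j. measure (cf_measure 0) (?A j))"
      by (rule summable_comparison_test_ev[rotated])
  qed
  then show ?thesis by (auto simp: not_less)
qed

text \<open>For \<open>n\<close> between \<open>2 ^ j\<close> and \<open>2 ^ (j + 1)\<close> the sum
  is largest at the right end and \<open>b\<close> smallest at the left end, which is exactly the
  pairing in the block bound. Taking \<open>\<epsilon>\<close> among the reciprocals keeps the
  exceptional null sets countable in number.\<close>

lemma AE_prime_digit_sums_tendsto_0:
  assumes summ: "summable (\<lambda>n. 1 / (b (Suc n) * ln (b (Suc n))))"
  shows "AE x in cf_measure 0. (\<lambda>n. (\<Sum>k=1..n. real (prime_digit k x)) / b n) \<longlonglongrightarrow> 0"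
proof -
  have "AE x in cf_measure 0. \<forall>r. \<forall>\<^sub>F j in sequentially.
      (\<Sum>k=1..2 ^ (j + 1). real (prime_digit k x)) \<le> inverse (real (Suc r)) * b (2 ^ j)"
    unfolding AE_all_countable
    by (intro allI AE_eventually_block_le[OF summ]) (auto simp: field_simps)
  then show ?thesis
  proof eventually_elim
    case (elim x)
    let ?S = "\<lambda>n. \<Sum>k=1..n. real (prime_digit k x)"
    show ?case
    proof (rule tendstoI)
      fix e :: real assume "e > 0"
      then obtain r where r: "inverse (real (Suc r)) < e" using reals_Archimedean by blast
      from elim obtain J where J: "\<And>j. j \<ge> J \<Longrightarrow> ?S (2 ^ (j + 1)) \<le> inverse (real (Suc r)) * b (2 ^ j)"
        unfolding eventually_sequentially by blast
      have "dist (?S n / b n) 0 < e" if n: "n \<ge> 2 ^ J" for n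
      proof -
        define j where "j = floor_log n"
        have n1: "n \<ge> 1" using n by (metis one_le_numeral one_le_power order_trans)
        have j: "2 ^ j \<le> n" "n \<le> 2 ^ (j + 1)"
          unfolding j_def using n1 floor_log_exp2_le[of n] floor_log_exp2_gt[of n] by auto
        have "(2::nat) ^ J < 2 ^ (j + 1)"
          using n n1 floor_log_exp2_gt[of n] by (simp add: j_def)
        then have "J < j + 1" by (simp only: power_strict_increasing_iff)
        then have Jj: "J \<le> j" by simp
        have bn: "b n > 1" using b_gt1 n1 by simp
        have "?S n \<le> ?S (2 ^ (j + 1))" using j by (intro sum_mono2) auto
        also have "\<dots> \<le> inverse (real (Suc r)) * b (2 ^ j)" by (rule J[OF Jj])
        also have "\<dots> \<le> inverse (real (Suc r)) * b n"
          using j by (intro mult_left_mono b_increasing) auto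
        also have "\<dots> < e * b n" using r bn by (intro mult_strict_right_mono) auto
        finally have "?S n / b n < e" using bn by (simp add: field_simps)
        moreover have "0 \<le> ?S n / b n" using bn by (intro divide_nonneg_nonneg sum_nonneg) auto
        ultimately show ?thesis by simp
      qed
      then show "\<forall>\<^sub>F n in sequentially. dist (?S n / b n) 0 < e"
        unfolding eventually_sequentially by blast
    qed
  qed
qed

section \<open>Exceedances in the divergent case\<close>

lemma AE_exceeds_after:
  assumes nsumm: "\<not> summable (\<lambda>n. 1 / (b (Suc n) * ln (b (Suc n))))"
    and K: "K \<ge> 1" and m: "m \<ge> 1" and bm: "\<And>k. k \<ge> m \<Longrightarrow> b k \<ge> K" "\<And>k. k \<ge> m \<Longrightarrow> b k \<ge> 8"
  shows "AE x in cf_measure 0. \<exists>k\<ge>m. K * b k < real (prime_digit k x)"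
proof -
  let ?a = "\<lambda>k. 1 / (b k * ln (b k))"
  let ?E = "{x. \<forall>k\<ge>m. real (prime_digit k x) \<le> K * b k}"
  have a0: "0 \<le> ?a (Suc k)" for k using b_gt1[of "Suc k"] by simp
  have unb: "\<exists>n. R < (\<Sum>k=m..n. ?a k)" for R
  proof (rule ccontr)
    assume "\<not> ?thesis"
    then have R: "(\<Sum>k=m..n. ?a k) \<le> R" for n by (auto simp: not_less)
    have "summable (\<lambda>n. ?a (Suc n))"
    proof (rule summableI_nonneg_bounded[OF a0])
      fix n
      have "(\<Sum>k<n. ?a (Suc k)) = (\<Sum>k=1..n. ?a k)"
        by (rule sum.reindex_bij_witness[of _ "\<lambda>k. k - 1" Suc]) auto
      also have "\<dots> \<le> (\<Sum>k\<in>{1..<m} \<union> {m..n}. ?a k)"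
      proof (rule sum_mono2)
        fix k assume "k \<in> {1..<m} \<union> {m..n} - {1..n}"
        then show "0 \<le> ?a k" using b_gt1[of k] m by auto
      qed auto
      also have "\<dots> = (\<Sum>k\<in>{1..<m}. ?a k) + (\<Sum>k=m..n. ?a k)"
        by (rule sum.union_disjoint) auto
      also have "\<dots> \<le> (\<Sum>k\<in>{1..<m}. ?a k) + R" using R by simp
      finally show "(\<Sum>k<n. ?a (Suc k)) \<le> (\<Sum>k\<in>{1..<m}. ?a k) + R" .
    qed
    then show False using nsumm by simp
  qed
  \<comment> \<open>Since \<open>K \<le> b k\<close>,
    \<open>ln (K * b k) \<le> 2 * ln (b k)\<close>; so the factor \<open>K\<close> changes the
    series only by this constant, with \<open>12288 = 2 * 6144\<close>.\<close>
  define c where "c = 1 / (12288 * K)"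
  have c: "c > 0" using K by (simp add: c_def)
  have bound: "emeasure (cf_measure 0) ?E \<le> ennreal (exp (- (c * (\<Sum>k=m..n. ?a k))))" for n
  proof -
    have "emeasure (cf_measure 0) ?E \<le> emeasure (cf_measure 0) {x. \<forall>k\<in>{m..n}. real (prime_digit k x) \<le> K * b k}"
      by (intro emeasure_mono) auto
    also have "\<dots> \<le> ennreal (exp (- (\<Sum>k=m..n. 1 / (6144 * (K * b k * ln (K * b k))))))"
    proof (rule emeasure_prime_digits_le_thresholds[OF m])
      fix k assume "m \<le> k"
      then have "1 * 8 \<le> K * b k" using K bm(2) by (intro mult_mono) auto
      then show "8 \<le> K * b k" by simp
    qed
    also have "\<dots> \<le> ennreal (exp (- (c * (\<Sum>k=m..n. ?a k))))"
    proof -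
      have "c * (\<Sum>k=m..n. ?a k) \<le> (\<Sum>k=m..n. 1 / (6144 * (K * b k * ln (K * b k))))"
        unfolding sum_distrib_left
      proof (rule sum_mono)
        fix k assume "k \<in> {m..n}"
        then have k: "K \<le> b k" "8 \<le> b k" using bm by auto
        have "ln (K * b k) = ln K + ln (b k)" using K k by (simp add: ln_mult)
        also have "\<dots> \<le> 2 * ln (b k)" using K k by simp
        finally have l: "ln (K * b k) \<le> 2 * ln (b k)" .
        have "1 * 8 \<le> K * b k" using K k by (intro mult_mono) auto
        then have l0: "0 < ln (K * b k)" by simp
        have "c * ?a k = 1 / (6144 * (K * b k * (2 * ln (b k))))" by (simp add: c_def)
        also have "\<dots> \<le> 1 / (6144 * (K * b k * ln (K * b k)))"
          using l l0 K k by (intro divide_left_mono mult_left_mono mult_pos_pos) auto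
        finally show "c * ?a k \<le> 1 / (6144 * (K * b k * ln (K * b k)))" .
      qed
      then show ?thesis by (intro ennreal_leI) simp
    qed
    finally show ?thesis .
  qed
  have "emeasure (cf_measure 0) ?E \<le> 0"
  proof (rule ennreal_le_epsilon)
    fix e :: real assume e: "0 < e"
    obtain n where "- ln e / c < (\<Sum>k=m..n. ?a k)" using unb by blast
    then have "- (c * (\<Sum>k=m..n. ?a k)) \<le> ln e" using c by (simp add: field_simps)
    then have "exp (- (c * (\<Sum>k=m..n. ?a k))) \<le> e" using e by (metis exp_le_cancel_iff exp_ln)
    then show "emeasure (cf_measure 0) ?E \<le> 0 + ennreal e"
      using order_trans[OF bound[of n] ennreal_leI] by simp
  qed
  then have "?E \<in> null_sets (cf_measure 0)" by (intro null_setsI) auto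
  then show ?thesis by (rule AE_I') (auto simp: not_less)
qed

text \<open>A single digit suffices: if the \<open>k\<close>-th prime digit exceeds
  \<open>(K + 1) * b k\<close>, so does the whole sum up to \<open>k\<close>. Letting the starting
  index \<open>m\<close> run through all naturals yields such \<open>k\<close> arbitrarily far
  out.\<close>

lemma AE_limsup_prime_digit_sums:
  assumes nsumm: "\<not> summable (\<lambda>n. 1 / (b (Suc n) * ln (b (Suc n))))"
  shows "AE x in cf_measure 0. limsup (\<lambda>n. ereal ((\<Sum>k=1..n. real (prime_digit k x)) / b n)) = \<infinity>"
proof -
  have ex: "AE x in cf_measure 0. \<exists>k\<ge>m. real (Suc K) * b k < real (prime_digit k x)" for K m
  proof -
    obtain m0 where m0: "\<And>k. k \<ge> m0 \<Longrightarrow> b k \<ge> max (real (Suc K)) 8"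
      using b_at_top unfolding filterlim_at_top eventually_sequentially by metis
    have "AE x in cf_measure 0. \<exists>k\<ge>max 1 (max m m0). real (Suc K) * b k < real (prime_digit k x)"
    proof (rule AE_exceeds_after[OF nsumm])
      fix k assume "k \<ge> max 1 (max m m0)"
      then show "real (Suc K) \<le> b k" "8 \<le> b k" using m0[of k] by auto
    qed auto
    then show ?thesis by eventually_elim auto
  qed
  have "AE x in cf_measure 0. \<forall>K m. \<exists>k\<ge>m. real (Suc K) * b k < real (prime_digit k x)"
    unfolding AE_all_countable using ex by blast
  then show ?thesis
  proof eventually_elim
    case (elim x)
    let ?f = "\<lambda>n. ereal ((\<Sum>k=1..n. real (prime_digit k x)) / b n)"
    show "limsup ?f = \<infinity>"
    proof (rule ccontr)
      assume "limsup ?f \<noteq> \<infinity>"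
      then obtain K where "limsup ?f < ereal (real K)" using less_PInf_Ex_of_nat by auto
      then have "\<forall>\<^sub>F n in sequentially. ?f n < ereal (real K)" by (rule Limsup_lessD)
      then obtain m where m: "\<And>n. n \<ge> m \<Longrightarrow> ?f n < ereal (real K)"
        unfolding eventually_sequentially by blast
      from elim obtain k where k: "k \<ge> max 1 m" "real (Suc K) * b k < real (prime_digit k x)" by blast
      have bk: "b k > 1" using k b_gt1 by simp
      have "real (prime_digit k x) \<le> (\<Sum>l=1..k. real (prime_digit l x))"
        using k(1) by (intro member_le_sum) auto
      then have "real (Suc K) * b k < (\<Sum>l=1..k. real (prime_digit l x))" using k(2) by linarith
      then have "real (Suc K) < (\<Sum>l=1..k. real (prime_digit l x)) / b k"
        using bk by (simp add: field_simps)
      then show False using m[of k] k(1) by simp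
    qed
  qed
qed

end

text \<open>Makes the two almost sure conclusions, limit 0 and limsup infinity, incompatible, which
  gives the converse in the equivalence.\<close>

lemma not_AE_False_unit_interval: "\<not> (AE x in lborel. x \<in> {0<..1::real} \<longrightarrow> False)"
proof
  assume "AE x in lborel. x \<in> {0<..1::real} \<longrightarrow> False"
  then have "{0<..1::real} \<in> null_sets lborel"
    by (subst AE_iff_null_sets) (auto elim: eventually_mono)
  then show False by (simp add: null_sets_def)
qed

theorem theorem2p6:
  fixes b :: "nat \<Rightarrow> real"
  assumes b_gt1: "\<And>n. n \<ge> 1 \<Longrightarrow> b n > 1"
    and b_mono: "\<And>m n. 1 \<le> m \<Longrightarrow> m \<le> n \<Longrightarrow> b m / real m \<le> b n / real n"
    and b_lim: "filterlim (\<lambda>n. b n / real n) at_top sequentially"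
  shows "((AE x in lborel. x \<in> {0<..1} \<longrightarrow>
            limsup (\<lambda>n. ereal ((\<Sum>k=1..n. real (prime_digit k x)) / b n)) = \<infinity>)
          \<longleftrightarrow> \<not> summable (\<lambda>n. 1 / (b (Suc n) * ln (b (Suc n)))))
       \<and> (summable (\<lambda>n. 1 / (b (Suc n) * ln (b (Suc n)))) \<longrightarrow>
           (AE x in lborel. x \<in> {0<..1} \<longrightarrow>
            ((\<lambda>n. (\<Sum>k=1..n. real (prime_digit k x)) / b n) \<longlonglongrightarrow> 0)))"
proof -
  interpret superlinear_norming b using assms by unfold_locales
  let ?q = "\<lambda>x n. (\<Sum>k=1..n. real (prime_digit k x)) / b n"
  have lim: "AE x in lborel. x \<in> {0<..1} \<longrightarrow> ?q x \<longlonglongrightarrow> 0"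
    if "summable (\<lambda>n. 1 / (b (Suc n) * ln (b (Suc n))))"
    by (rule AE_cf_measure_0D[OF AE_prime_digit_sums_tendsto_0[OF that]])
  have div: "AE x in lborel. x \<in> {0<..1} \<longrightarrow> limsup (\<lambda>n. ereal (?q x n)) = \<infinity>"
    if "\<not> summable (\<lambda>n. 1 / (b (Suc n) * ln (b (Suc n))))"
    by (rule AE_cf_measure_0D[OF AE_limsup_prime_digit_sums[OF that]])
  have "\<not> summable (\<lambda>n. 1 / (b (Suc n) * ln (b (Suc n))))"
    if "AE x in lborel. x \<in> {0<..1} \<longrightarrow> limsup (\<lambda>n. ereal (?q x n)) = \<infinity>"
  proof
    assume "summable (\<lambda>n. 1 / (b (Suc n) * ln (b (Suc n))))"
    from lim[OF this] that have "AE x in lborel. x \<in> {0<..1::real} \<longrightarrow> False"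
    proof eventually_elim
      case (elim x)
      show ?case
      proof
        assume "x \<in> {0<..1}"
        then have "?q x \<longlonglongrightarrow> 0" and inf: "limsup (\<lambda>n. ereal (?q x n)) = \<infinity>" using elim by auto
        then have "(\<lambda>n. ereal (?q x n)) \<longlonglongrightarrow> ereal 0" by (simp only: lim_ereal)
        then have "limsup (\<lambda>n. ereal (?q x n)) = ereal 0" by (rule lim_imp_Limsup[OF sequentially_bot])
        then show False using inf by simp
      qed
    qed
    then show False using not_AE_False_unit_interval by contradiction
  qed
  then show ?thesis using lim div by blast
qed

end
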